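(* Let $k$ be a field, let $R=k[x_0,x_1,x_2]$, and let $I\subset R$ be an ideal of codimension $2$ generated by $3$ linearly independent forms of degree $d\geq 1$, with minimal graded free resolution $$0\rightarrow\bigoplus_{m=1}^{r-2}R(-D_m)\longrightarrow \bigoplus_{i=1}^{r}R(-d_i)\longrightarrow R(-d)^{3}\rightarrow R\rightarrow R/I \rightarrow 0,\qquad r\geq 3,$$ and assume $\operatorname{indeg}(I^{\rm sat}/I)\geq d+1$. Then: (i) If $d=5$, the minimal free resolution of $R/I$ is $0\rightarrow R(-9)\rightarrow R(-8)^3\rightarrow R(-5)^3\rightarrow R$. (ii) If $d=6$, the minimal free resolution of $R/I$ is one of the following: $0\rightarrow R(-11)^2\rightarrow R(-10)^4\rightarrow R(-6)^3\rightarrow R$, or $0\rightarrow R(-11)\rightarrow R(-10)^2\oplus R(-9)\rightarrow R(-6)^3\rightarrow R$. (iii) If $d=7$, the minimal free resolution of $R/I$ is one of the following: $0\rightarrow R(-13)^3\rightarrow R(-12)^5\rightarrow R(-7)^3\rightarrow R$, $0\rightarrow R(-13)^2\rightarrow R(-12)^3\oplus R(-11)\rightarrow R(-7)^3\rightarrow R$, $0\rightarrow R(-13)\rightarrow R(-12)\oplus R(-11)^2\rightarrow R(-7)^3\rightarrow R$, $0\rightarrow R(-12)\rightarrow R(-11)^3\rightarrow R(-7)^3\rightarrow R$, or $0\rightarrow R(-13)\rightarrow R(-12)^2\oplus R(-10)\rightarrow R(-7)^3\rightarrow R$.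
   Context: $R$ has the standard grading and $\mathfrak m=(x_0,x_1,x_2)$. $I^{\rm sat}=I:\mathfrak m^{\infty}$. For a graded module $M$, $\operatorname{indeg}(M)=\inf\{\mu: M_\mu\neq 0\}$ (with $\operatorname{indeg}(0)=+\infty$). The condition $r\ge3$ means that the last free module of the minimal resolution is nonzero, i.e. $I$ is not saturated. *)

theory Defs
  imports
    "HOL-Library.Poly_Mapping"
    "HOL-Library.Numeral_Type"
    "HOL-Library.Multiset"
    "HOL-Library.Extended_Nat"
    "Jordan_Normal_Form.Matrix_Kernel"
begin

text \<open>Ideals are the submodules of the ring over itself, so the ideal generated by a set is its span.\<close>

abbreviation ideal_of :: "'a::comm_ring_1 set \<Rightarrow> 'a set" where
  "ideal_of \<equiv> Modules.module.span (*)"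

abbreviation is_ideal :: "'a::comm_ring_1 set \<Rightarrow> bool" where
  "is_ideal \<equiv> Modules.module.subspace (*)"

definition is_prime_ideal :: "'a::comm_ring_1 set \<Rightarrow> bool" where
  "is_prime_ideal P \<longleftrightarrow>
     is_ideal P \<and> P \<noteq> UNIV \<and> (\<forall>a b. a * b \<in> P \<longrightarrow> a \<in> P \<or> b \<in> P)"

definition height :: "'a::comm_ring_1 set \<Rightarrow> enat" where
  "height P = Sup {enat n | n C.
     (\<forall>i\<le>n. is_prime_ideal (C i)) \<and> (\<forall>i<n. C i \<subset> C (Suc i)) \<and> C n = P}"

definition codim :: "'a::comm_ring_1 set \<Rightarrow> enat" where
  "codim I = (INF P \<in> {P. is_prime_ideal P \<and> I \<subseteq> P}. height P)"

fun ideal_power :: "'a::comm_ring_1 set \<Rightarrow> nat \<Rightarrow> 'a set" where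
  "ideal_power J 0 = UNIV"
| "ideal_power J (Suc n) = ideal_of {a * b | a b. a \<in> J \<and> b \<in> ideal_power J n}"

definition colon :: "'a::comm_ring_1 set \<Rightarrow> 'a set \<Rightarrow> 'a set" where
  "colon I J = {f. \<forall>g\<in>J. f * g \<in> I}"

text \<open>
  The type \<open>3\<close> of \<^theory>\<open>HOL-Library.Numeral_Type\<close> has exactly the elements \<open>0\<close>, \<open>1\<close>, \<open>2\<close> and
  indexes the variables.  A polynomial is a finitely supported map from exponent
  vectors to coefficients; multiplication on \<^type>\<open>poly_mapping\<close> is convolution.
\<close>

type_synonym 'k R = "(3 \<Rightarrow>\<^sub>0 nat) \<Rightarrow>\<^sub>0 'k"

definition var :: "3 \<Rightarrow> 'k::field R" where
  "var i = Poly_Mapping.single (Poly_Mapping.single i 1) 1"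

definition scalar_mult :: "'k::field \<Rightarrow> 'k R \<Rightarrow> 'k R" where
  "scalar_mult c p = Poly_Mapping.single 0 c * p"

definition mon_deg :: "(3 \<Rightarrow>\<^sub>0 nat) \<Rightarrow> nat" where
  "mon_deg m = (\<Sum>i\<in>UNIV. Poly_Mapping.lookup m i)"

text \<open>Degrees are integers, so that for \<open>n < 0\<close> only the zero polynomial is homogeneous of degree \<open>n\<close>.\<close>

definition homogeneous :: "int \<Rightarrow> 'k::field R \<Rightarrow> bool" where
  "homogeneous n p \<longleftrightarrow> (\<forall>m\<in>Poly_Mapping.keys p. int (mon_deg m) = n)"

definition max_ideal :: "'k::field R set" where
  "max_ideal = ideal_of {var 0, var 1, var 2}"

definition saturation :: "'k::field R set \<Rightarrow> 'k R set" where
  "saturation I = (\<Union>n. colon I (ideal_power max_ideal n))"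

lemma module_times: "Modules.module ((*) :: 'a::comm_ring_1 \<Rightarrow> 'a \<Rightarrow> 'a)"
  by standard (simp_all add: algebra_simps)

lemma vector_space_scalar_mult: "vector_space (scalar_mult :: 'k::field \<Rightarrow> _)"
  by standard
    (simp_all add: scalar_mult_def algebra_simps single_add mult_single flip: mult.assoc)

text \<open>
  \<open>quotient_piece J I \<mu>\<close> is the degree \<open>\<mu>\<close> part of \<open>J / I\<close>, as a set of cosets; it is zero
  iff it consists of the coset \<open>I\<close> alone.  All pieces of negative degree are zero.  The infimum
  of the empty set in \<^typ>\<open>enat\<close> is \<open>\<infinity>\<close>, the initial degree of the zero module.
\<close>

definition quotient_piece :: "'k::field R set \<Rightarrow> 'k R set \<Rightarrow> nat \<Rightarrow> 'k R set set" where
  "quotient_piece J I \<mu> = (\<lambda>f. (+) f ` I) ` {f \<in> J. homogeneous (int \<mu>) f}"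

definition indeg_quotient :: "'k::field R set \<Rightarrow> 'k R set \<Rightarrow> enat" where
  "indeg_quotient J I = (INF \<mu> \<in> {\<mu>. quotient_piece J I \<mu> \<noteq> {I}}. enat \<mu>)"

text \<open>
  A list \<open>[a\<^sub>1, \<dots>, a\<^sub>s]\<close> of integers stands for the graded free module
  \<open>R(-a\<^sub>1) \<oplus> \<dots> \<oplus> R(-a\<^sub>s)\<close>, whose underlying module is \<open>carrier_vec s\<close>; the empty list
  stands for \<open>0\<close>.  A degree-preserving homomorphism \<open>\<Oplus>\<^sub>j R(-b\<^sub>j) \<rightarrow> \<Oplus>\<^sub>i R(-a\<^sub>i)\<close>
  is a matrix whose \<open>(i,j)\<close> entry is homogeneous of degree \<open>b\<^sub>j - a\<^sub>i\<close>.
\<close>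

definition graded_hom :: "int list \<Rightarrow> int list \<Rightarrow> 'k::field R mat \<Rightarrow> bool" where
  "graded_hom b a A \<longleftrightarrow> A \<in> carrier_mat (length a) (length b) \<and>
     (\<forall>i<length a. \<forall>j<length b. homogeneous (b ! j - a ! i) (A $$ (i, j)))"

definition mat_image :: "'a::comm_ring_1 mat \<Rightarrow> 'a vec set" where
  "mat_image A = (\<lambda>v. A *\<^sub>v v) ` carrier_vec (dim_col A)"

text \<open>
  \<open>minimal_graded_free_resolution I Fs \<phi>s\<close>: with \<open>Fs = [F\<^sub>0, \<dots>, F\<^sub>n]\<close> and
  \<open>\<phi>s ! i : F\<^sub>i\<^sub>+\<^sub>1 \<rightarrow> F\<^sub>i\<close>, the complex \<open>0 \<rightarrow> F\<^sub>n \<rightarrow> \<dots> \<rightarrow> F\<^sub>1 \<rightarrow> F\<^sub>0 = R \<rightarrow> R/I \<rightarrow> 0\<close> is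
  exact, and \<open>\<phi>s ! i\<close> maps \<open>F\<^sub>i\<^sub>+\<^sub>1\<close> into \<open>max_ideal F\<^sub>i\<close>, i.e. has all entries in \<open>max_ideal\<close>.
  \<open>resolution_image Fs \<phi>s i\<close> is the image in \<open>F\<^sub>i\<close> of the map entering it, which is zero for
  \<open>i = n\<close>.
\<close>

definition resolution_image :: "int list list \<Rightarrow> 'k::field R mat list \<Rightarrow> nat \<Rightarrow> 'k R vec set" where
  "resolution_image Fs \<phi>s i =
     (if i < length \<phi>s then mat_image (\<phi>s ! i) else {0\<^sub>v (length (Fs ! i))})"

definition minimal_graded_free_resolution ::
    "'k::field R set \<Rightarrow> int list list \<Rightarrow> 'k R mat list \<Rightarrow> bool" where
  "minimal_graded_free_resolution I Fs \<phi>s \<longleftrightarrow>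
     length Fs = Suc (length \<phi>s) \<and> Fs ! 0 = [0] \<and>
     (\<forall>i<length \<phi>s. graded_hom (Fs ! Suc i) (Fs ! i) (\<phi>s ! i)) \<and>
     resolution_image Fs \<phi>s 0 = {v \<in> carrier_vec 1. v $ 0 \<in> I} \<and>
     (\<forall>i<length \<phi>s. mat_kernel (\<phi>s ! i) = resolution_image Fs \<phi>s (Suc i)) \<and>
     (\<forall>i<length \<phi>s. elements_mat (\<phi>s ! i) \<subseteq> max_ideal)"

text \<open>
  The graded free modules in a resolution, up to isomorphism: \<open>R(-a\<^sub>1) \<oplus> \<dots> \<oplus> R(-a\<^sub>s)\<close>
  is determined by the multiset of the \<open>a\<^sub>i\<close>.
\<close>

definition free_modules :: "int list list \<Rightarrow> int multiset list" where
  "free_modules Fs = map mset Fs"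

end

theory Submission
  imports
    Defs
    "HOL-Library.Function_Algebras"
    "Berlekamp_Zassenhaus.Unique_Factorization_Poly"
begin

text \<open>
  Write \<open>0 \<rightarrow> F\<^sub>3 \<rightarrow> F\<^sub>2 \<rightarrow> F\<^sub>1 \<rightarrow> R\<close> for the resolution, \<open>f\<close> for the row of the three forms, \<open>V\<close> and \<open>W\<close>
  for the matrices of \<open>F\<^sub>2 \<rightarrow> F\<^sub>1\<close> and \<open>F\<^sub>3 \<rightarrow> F\<^sub>2\<close>, and \<open>t = r - 2\<close>.  The lists of degrees are pinned
  down by three constraints, where \<open>d\<^sub>i\<close> and \<open>D\<^sub>j\<close> are taken in increasing order in the second one:

  \<^item> \<open>\<Sum> d\<^sub>i = 3 d + \<Sum> D\<^sub>j\<close> (\<open>degree_sum\<close>);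
  \<^item> \<open>d\<^sub>j\<^sub>+\<^sub>2 < D\<^sub>j\<close> for all \<open>j\<close> (\<open>degree_gap\<close> and \<open>sorted_degree_gap\<close>);
  \<^item> \<open>D\<^sub>j \<le> 2 d - 1\<close> for all \<open>j\<close> (\<open>last_degree_le\<close>), which is where the initial degree enters.

  The first two give \<open>d\<^sub>1 + d\<^sub>2 = 3 d + \<Sum> (D\<^sub>j - d\<^sub>j\<^sub>+\<^sub>2) \<ge> 3 d + t\<close>, while the last two bound \<open>d\<^sub>1\<close> and
  \<open>d\<^sub>2\<close> by \<open>2 d - 2\<close>.  Hence \<open>t \<le> d - 4\<close> (\<open>degree_lists\<close>), and for \<open>d = 5, 6, 7\<close> only the listed degrees remain.

  The codimension is used in one form only: the three forms have no common prime factor, so that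
  \<open>q\<close> divides \<open>h\<close> as soon as it divides \<open>f\<^sub>a h\<close> for every \<open>a\<close> (\<open>codim_2_grade\<close>).  This rests on unique
  factorization in \<open>R\<close>.

  The sum of the degrees is read off from the Hilbert function of the syzygy module \<open>ker f\<close>.  The
  resolution expresses it through the \<open>d\<^sub>i\<close> and \<open>D\<^sub>j\<close>; rank and nullity of \<open>f\<close> bound it from below;
  and projecting a syzygy to its third entry bounds it from above.  For large \<open>n\<close> all three are
  quadratic polynomials in \<open>n\<close> with the same leading coefficient, and the two bounds also share their
  linear coefficient; so this is the linear coefficient of the first, which is the assertion.

  For the gap, columns of \<open>W\<close> of small degree are supported in few rows.  If there were too few of
  these rows, the corresponding columns of \<open>V\<close> would be multiples of one syzygy, which contradicts
  minimality.

  For the last bound, lift the Koszul syzygies of \<open>f\<close> through \<open>V\<close> to a matrix \<open>\<alpha>\<close>, and let \<open>g\<close> be the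
  vector with \<open>\<alpha> f = W g\<close>, which is the component in homological degree three of a comparison map
  from the Koszul complex to the resolution.  Its entry \<open>g\<^sub>j\<close> is a form of degree \<open>3 d - D\<^sub>j\<close>.  It does
  not lie in \<open>I\<close> (\<open>g_notin_ideal\<close>), because \<open>I\<close> annihilates the Koszul homology and has grade two.  It
  lies in the saturation (\<open>high_degree_multiple_in_ideal\<close>), because the transpose of \<open>W\<close> is surjective
  in high degrees by a dimension count (\<open>row_map_surjective\<close>).  So its degree exceeds \<open>d\<close>.
\<close>

section \<open>Unique factorization in the polynomial ring\<close>

lemma poly_mapping_eq_sum_single:
  "p = (\<Sum>m\<in>Poly_Mapping.keys p. Poly_Mapping.single m (Poly_Mapping.lookup p m))"
proof (rule poly_mapping_eqI)
  fix k
  show "Poly_Mapping.lookup p k = Poly_Mapping.lookup (\<Sum>m\<in>Poly_Mapping.keys p. Poly_Mapping.single m (Poly_Mapping.lookup p m)) k"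
    by (simp add: lookup_sum lookup_single when_def in_keys_iff)
qed

definition nested_monom :: "(3 \<Rightarrow>\<^sub>0 nat) \<Rightarrow> 'k::field \<Rightarrow> 'k poly poly poly" where
  "nested_monom m c = Polynomial.monom (Polynomial.monom (Polynomial.monom c
     (Poly_Mapping.lookup m 0)) (Poly_Mapping.lookup m 1)) (Poly_Mapping.lookup m 2)"

text \<open>
  An isomorphism onto an iterated univariate polynomial ring, along which unique factorization is
  carried over to \<^typ>\<open>'k R\<close>.
\<close>

definition nested :: "'k::field R \<Rightarrow> 'k poly poly poly" where
  "nested p = (\<Sum>m\<in>Poly_Mapping.keys p. nested_monom m (Poly_Mapping.lookup p m))"

lemma nested_monom_0 [simp]: "nested_monom m 0 = 0"
  by (simp add: nested_monom_def)

lemma nested_monom_add: "nested_monom m (a + b) = nested_monom m a + nested_monom m b"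
  by (simp add: nested_monom_def add_monom)

lemma nested_monom_mult: "nested_monom m a * nested_monom m' b = nested_monom (m + m') (a * b)"
  by (simp add: nested_monom_def mult_monom lookup_add)

lemma nested_0 [simp]: "nested 0 = 0"
  by (simp add: nested_def)

lemma nested_single [simp]: "nested (Poly_Mapping.single m c) = nested_monom m c"
  by (simp add: nested_def)

lemma nested_add: "nested (p + q) = nested p + nested q"
  unfolding nested_def
  by (rule setsum_keys_plus_distrib) (simp_all add: nested_monom_add)

lemma nested_sum: "nested (sum g A) = (\<Sum>x\<in>A. nested (g x))"
  by (induction A rule: infinite_finite_induct) (simp_all add: nested_add)

lemma nested_mult: "nested (p * q) = nested p * nested q"
proof -
  have "p * q = (\<Sum>m\<in>Poly_Mapping.keys p. Poly_Mapping.single m (Poly_Mapping.lookup p m)) *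
      (\<Sum>m\<in>Poly_Mapping.keys q. Poly_Mapping.single m (Poly_Mapping.lookup q m))"
    by (rule arg_cong2[where f = times]) (rule poly_mapping_eq_sum_single)+
  also have "\<dots> = (\<Sum>m\<in>Poly_Mapping.keys p. \<Sum>m'\<in>Poly_Mapping.keys q.
      Poly_Mapping.single (m + m') (Poly_Mapping.lookup p m * Poly_Mapping.lookup q m'))"
    by (simp add: sum_product mult_single)
  also have "nested \<dots> = nested p * nested q"
    by (simp add: nested_sum nested_monom_mult[symmetric] sum_product[symmetric]
        nested_def[of p] nested_def[of q])
  finally show ?thesis .
qed

lemma nested_1 [simp]: "nested 1 = 1"
  by (simp add: nested_def nested_monom_def monom_0)

lemma exhaust_type_3: "(i::3) = 0 \<or> i = 1 \<or> i = 2"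
proof (cases i rule: bit1_cases)
  case (of_int z)
  then have "z = 0 \<or> z = 1 \<or> z = 2" by auto
  with of_int show ?thesis by auto
qed

text \<open>
  The coefficients survive the passage to nested polynomials.  This gives injectivity; the case
  \<open>m = 0\<close> also shows that taking the constant coefficient is multiplicative.
\<close>

lemma coeff_nested:
  "poly.coeff (poly.coeff (poly.coeff (nested p) (Poly_Mapping.lookup m 2)) (Poly_Mapping.lookup m 1)) 
     (Poly_Mapping.lookup m 0) = Poly_Mapping.lookup p m"
proof -
  have eq: "m' = m" if "Poly_Mapping.lookup m' 0 = Poly_Mapping.lookup m 0" 
    "Poly_Mapping.lookup m' 1 = Poly_Mapping.lookup m 1" "Poly_Mapping.lookup m' 2 = Poly_Mapping.lookup m 2"
    for m' :: "3 \<Rightarrow>\<^sub>0 nat"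
    by (rule poly_mapping_eqI) (metis that exhaust_type_3)
  have c: "poly.coeff (poly.coeff (poly.coeff (nested_monom m' c) (Poly_Mapping.lookup m 2)) (Poly_Mapping.lookup m 1)) 
     (Poly_Mapping.lookup m 0) = (if m' = m then c else 0)" for m' c
    using eq[of m'] by (auto simp: nested_monom_def)
  show ?thesis
    by (simp add: nested_def coeff_sum c in_keys_iff)
qed

lemma inj_nested: "inj nested"
proof (rule injI)
  fix p q :: "'a R" assume "nested p = nested q"
  then show "p = q"
    by (intro poly_mapping_eqI) (metis coeff_nested)
qed

text \<open>
  Surjectivity of \<open>nested\<close> follows by applying this to its range, once for each variable.
\<close>

lemma poly_in_subring:
  fixes S :: "'a::comm_ring_1 poly set"
  assumes "\<And>c. [:c:] \<in> S" "[:0, 1:] \<in> S" "\<And>p q. p \<in> S \<Longrightarrow> q \<in> S \<Longrightarrow> p + q \<in> S"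
    "\<And>p q. p \<in> S \<Longrightarrow> q \<in> S \<Longrightarrow> p * q \<in> S"
  shows "p \<in> S"
proof (induction p)
  case 0
  then show ?case using assms(1)[of 0] by simp
next
  case (pCons a p)
  have "pCons a p = [:a:] + [:0, 1:] * p" by simp
  then show ?case using assms pCons by metis
qed

lemma surj_nested: "surj (nested :: 'k::field R \<Rightarrow> _)"
proof -
  let ?S = "range (nested :: 'k R \<Rightarrow> _)"
  have add: "p + q \<in> ?S" and mult: "p * q \<in> ?S" if "p \<in> ?S" "q \<in> ?S" for p q
  proof -
    from that obtain p' q' where "p = nested p'" "q = nested q'" by blast
    then have "p + q = nested (p' + q')" "p * q = nested (p' * q')"
      by (simp_all add: nested_add nested_mult)
    then show "p + q \<in> ?S" "p * q \<in> ?S" by blast+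
  qed
  have gen: "nested_monom m c \<in> ?S" for m and c :: 'k
    by (metis nested_single rangeI)
  have l1: "[:[:p:]:] \<in> ?S" for p
  proof -
    have "p \<in> {p. [:[:p:]:] \<in> ?S}"
    proof (rule poly_in_subring)
      fix c show "[:c:] \<in> {p. [:[:p:]:] \<in> ?S}"
        using gen[of 0 c] by (simp add: nested_monom_def monom_0)
      show "[:0, 1:] \<in> {p. [:[:p:]:] \<in> ?S}"
        using gen[of "Poly_Mapping.single 0 1" 1] 
        by (simp add: nested_monom_def monom_0 monom_Suc lookup_single)
    next
      fix p q assume "p \<in> {p. [:[:p:]:] \<in> ?S}" "q \<in> {p. [:[:p:]:] \<in> ?S}"
      with add[of "[:[:p:]:]" "[:[:q:]:]"] mult[of "[:[:p:]:]" "[:[:q:]:]"]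
      show "p + q \<in> {p. [:[:p:]:] \<in> ?S}" "p * q \<in> {p. [:[:p:]:] \<in> ?S}"
        by (simp_all add: mult.commute)
    qed
    then show ?thesis by simp
  qed
  have l2: "[:p:] \<in> ?S" for p
  proof -
    have "p \<in> {p. [:p:] \<in> ?S}"
    proof (rule poly_in_subring)
      fix c show "[:c:] \<in> {p. [:p:] \<in> ?S}"
        using l1 by simp
      show "[:0, 1:] \<in> {p. [:p:] \<in> ?S}"
        using gen[of "Poly_Mapping.single 1 1" 1] 
        by (simp add: nested_monom_def monom_0 monom_Suc lookup_single)
    next
      fix p q assume "p \<in> {p. [:p:] \<in> ?S}" "q \<in> {p. [:p:] \<in> ?S}"
      with add[of "[:p:]" "[:q:]"] mult[of "[:p:]" "[:q:]"]
      show "p + q \<in> {p. [:p:] \<in> ?S}" "p * q \<in> {p. [:p:] \<in> ?S}"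
        by (simp_all add: mult.commute)
    qed
    then show ?thesis by simp
  qed
  have "p \<in> ?S" for p
  proof (rule poly_in_subring)
    fix c show "[:c:] \<in> ?S"
        using l2 by simp
      show "[:0, 1:] \<in> ?S"
        using gen[of "Poly_Mapping.single 2 1" 1] 
        by (simp add: nested_monom_def monom_0 monom_Suc lookup_single)
  qed (use add mult in auto)
  then show ?thesis by blast
qed

lemma nested_dvd_iff: "nested p dvd nested q \<longleftrightarrow> p dvd q"
proof
  assume "nested p dvd nested q"
  then obtain c where "nested q = nested p * c" by (elim dvdE)
  then obtain c' where "nested q = nested (p * c')" using surj_nested by (metis nested_mult surjD)
  then show "p dvd q" using inj_nested by (metis dvd_triv_left injD)
qed (auto simp: nested_mult dvd_def)

text \<open>
  The last property is the form in which coprimality of \<open>P'\<close> and \<open>Q'\<close> gets used.  It holds since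
  \<open>g P'\<close> divides both \<open>g P' x\<close> and \<open>g Q' x\<close>, hence also \<open>g x\<close>.
\<close>

lemma gcd_split:
  fixes P Q :: "'k::field R"
  assumes "P \<noteq> 0"
  obtains g P' Q' where "P = g * P'" "Q = g * Q'" "\<And>x. P' dvd Q' * x \<Longrightarrow> P' dvd x"
proof -
  obtain g where g: "some_gcd (nested P) (nested Q) = nested g"
    using surj_nested by (metis surjD)
  have "nested g dvd nested P" "nested g dvd nested Q"
    by (simp_all flip: g)
  then obtain P' Q' where PQ: "P = g * P'" "Q = g * Q'"
    by (auto simp: nested_dvd_iff elim!: dvdE)
  have "P' dvd x" if "P' dvd Q' * x" for x
  proof -
    have g0: "g \<noteq> 0" using PQ assms by auto
    have "P dvd Q * x" using that PQ by (auto simp: mult.assoc)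
    moreover have "P dvd P * x" by simp
    ultimately have "nested P dvd some_gcd (nested P) (nested Q) * nested x"
      by (intro some_gcd.gcd_greatest_mult) (simp_all flip: nested_mult add: nested_dvd_iff)
    then have "P dvd g * x" by (simp add: g nested_dvd_iff flip: nested_mult)
    with g0 show ?thesis by (simp add: PQ)
  qed
  with PQ that show ?thesis by blast
qed

lemma prime_divisor_ex:
  fixes a :: "'k::field R"
  assumes "a \<noteq> 0" "\<not> a dvd 1"
  obtains p where "prime_elem p" "p dvd a"
proof -
  have "nested a \<noteq> 0" using assms(1) inj_nested by (metis injD nested_0)
  moreover have "\<not> nested a dvd 1" using assms(2) nested_dvd_iff[of a 1] by simp
  ultimately obtain F where F: "mset_factors F (nested a)" using mset_factors_exist by blast
  then obtain q where q: "q \<in># F" "prime_elem q" "q dvd nested a"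
    by (metis (no_types) dvd_prod_mset mset_factorsD multiset_nonemptyE prime_elem_iff_irreducible)
  obtain p where p: "q = nested p" using surj_nested by (metis surjD)
  have "prime_elem p"
  proof (rule prime_elemI)
    show "p \<noteq> 0" using q p by auto
    show "\<not> p dvd 1" using q p nested_dvd_iff[of p 1] by (auto simp: prime_elem_def)
    show "p dvd a \<or> p dvd b" if "p dvd a * b" for a b
      using that q(2) unfolding p by (metis nested_dvd_iff nested_mult prime_elem_dvd_mult_iff)
  qed
  moreover have "p dvd a" using q p by (simp add: nested_dvd_iff)
  ultimately show ?thesis by (rule that)
qed

section \<open>Dimensions of kernels and images\<close>

context vector_space
begin

lemma dim_mono_finite:
  assumes "S \<subseteq> T" "T \<subseteq> span B" "finite B"
  shows "dim S \<le> dim T"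
proof -
  obtain A where A: "A \<subseteq> S" "independent A" "S \<subseteq> span A" "card A = dim S"
    using basis_exists by blast
  obtain C where C: "C \<subseteq> T" "independent C" "T \<subseteq> span C" "card C = dim T"
    using basis_exists by blast
  have "finite C" using independent_span_bound[of B C] C assms by auto
  moreover have "A \<subseteq> span C" using A C assms by auto
  ultimately show ?thesis using independent_span_bound[of C A] A C by simp
qed

lemma subspace_eq_of_dim_le:
  assumes "subspace S" "S \<subseteq> T" "T \<subseteq> span B" "finite B" "dim T \<le> dim S"
  shows "S = T"
proof (rule ccontr)
  assume "S \<noteq> T"
  then obtain x where x: "x \<in> T" "x \<notin> S" using assms by blast
  obtain A where A: "A \<subseteq> S" "independent A" "S \<subseteq> span A" "card A = dim S"
    using basis_exists by blast
  obtain C where C: "C \<subseteq> T" "independent C" "T \<subseteq> span C" "card C = dim T"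
    using basis_exists by blast
  have fC: "finite C" using independent_span_bound[of B C] C assms by auto
  have xA: "x \<notin> span A" using A x assms(1) by (metis span_minimal subsetD)
  have "independent (insert x A)" using xA A by (simp add: independent_insertI)
  moreover have "insert x A \<subseteq> span C" using A C assms x by auto
  ultimately have b: "finite (insert x A) \<and> card (insert x A) \<le> card C"
    by (rule independent_span_bound[OF fC])
  moreover have "x \<notin> A" using xA span_base by blast
  ultimately show False using A(4) C(4) assms(5) b by simp
qed

end

context vector_space_pair
begin

text \<open>
  Only \<open>S\<close> has to be finite-dimensional, not the ambient space.  A basis of the kernel is extended to
  a basis of \<open>S\<close>, and the new vectors map to a basis of the image.
\<close>

lemma rank_nullity:
  assumes f: "Vector_Spaces.linear s1 s2 f" and S: "vs1.subspace S" "S \<subseteq> vs1.span B" "finite B"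
  shows "vs1.dim S = vs1.dim {x \<in> S. f x = 0} + vs2.dim (f ` S)"
proof -
  interpret f: Vector_Spaces.linear s1 s2 f by (fact f)
  let ?K = "{x \<in> S. f x = 0}"
  obtain A where A: "A \<subseteq> ?K" "vs1.independent A" "?K \<subseteq> vs1.span A" "card A = vs1.dim ?K"
    using vs1.basis_exists by blast
  obtain C where C: "A \<subseteq> C" "C \<subseteq> S" "vs1.independent C" "S \<subseteq> vs1.span C"
    using vs1.maximal_independent_subset_extend[of A S] A by auto
  have fC: "finite C" using vs1.independent_span_bound[of B C] C S by auto
  have ker: "x = 0" if x: "x \<in> vs1.span (C - A)" "f x = 0" for x
  proof -
    have "x \<in> S" using x S(1) C(2) by (metis Diff_subset subset_trans subsetD vs1.span_minimal)
    then have xA: "x \<in> vs1.span A" using A x by auto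
    have "vs1.representation C x = vs1.representation (C - A) x"
      using C x by (intro vs1.representation_extend) auto
    moreover have "vs1.representation C x = vs1.representation A x"
      using C xA by (intro vs1.representation_extend) auto
    ultimately have "vs1.representation C x b = 0" for b
      by (metis DiffD2 vs1.representation_ne_zero)
    moreover have "x \<in> vs1.span C" using xA C vs1.span_mono by blast
    ultimately show "x = 0"
      using vs1.sum_nonzero_representation_eq[OF C(3), of x] by simp
  qed
  have inj: "inj_on f (vs1.span (C - A))"
  proof (rule inj_onI)
    fix x y assume xy: "x \<in> vs1.span (C - A)" "y \<in> vs1.span (C - A)" "f x = f y"
    then have "x - y \<in> vs1.span (C - A)" "f (x - y) = 0"
      by (simp_all add: vs1.span_diff f.diff)
    then show "x = y" using ker by fastforce
  qed
  have ind: "vs1.independent (C - A)" using C(3) vs1.independent_mono by blast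
  have "vs2.independent (f ` (C - A))"
    using f.independent_injective_image[OF ind inj] .
  moreover have "f ` (C - A) \<subseteq> f ` S" using C by auto
  moreover have "f ` S \<subseteq> vs2.span (f ` (C - A))"
  proof
    fix y assume "y \<in> f ` S"
    then have "y \<in> f ` vs1.span C" using C by auto
    then have "y \<in> vs2.span (f ` C)" by (simp add: f.span_image)
    moreover have "f ` C \<subseteq> vs2.span (f ` (C - A))"
    proof
      fix z assume "z \<in> f ` C"
      then obtain c where c: "z = f c" "c \<in> C" by auto
      show "z \<in> vs2.span (f ` (C - A))"
      proof (cases "c \<in> A")
        case True
        then have "z = 0" using A c by auto
        then show ?thesis by (simp add: vs2.span_zero)
      next
        case False
        then show ?thesis using c by (auto intro: vs2.span_base)
      qed
    qed
    ultimately show "y \<in> vs2.span (f ` (C - A))"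
      by (metis subsetD vs2.span_minimal vs2.subspace_span)
  qed
  ultimately have "card (f ` (C - A)) = vs2.dim (f ` S)"
    by (intro vs2.basis_card_eq_dim)
  moreover have "card (f ` (C - A)) = card (C - A)"
    using inj by (intro card_image) (meson inj_on_subset vs1.span_superset)
  moreover have "card C = vs1.dim S" using C by (intro vs1.basis_card_eq_dim)
  moreover have "card (C - A) = card C - card A" "card A \<le> card C"
    using C fC by (auto intro: card_Diff_subset card_mono finite_subset)
  ultimately show ?thesis using A by simp
qed

end

section \<open>Homogeneous components\<close>

lemma UNIV_type_3: "(UNIV :: 3 set) = {0, 1, 2}"
  using exhaust_type_3 by blast

lemma distinct_type_3: "(0::3) \<noteq> 1" "(0::3) \<noteq> 2" "(1::3) \<noteq> 2"
proof -
  have "card {0, 1, 2::3} = 3" by (simp flip: UNIV_type_3)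
  then show "(0::3) \<noteq> 1" "(0::3) \<noteq> 2" "(1::3) \<noteq> 2"
    by (auto simp: card_insert_if split: if_splits)
qed

lemma mon_deg_eq: "mon_deg m = Poly_Mapping.lookup m 0 + Poly_Mapping.lookup m 1 + Poly_Mapping.lookup m 2"
  unfolding mon_deg_def UNIV_type_3 using distinct_type_3 by simp

lemma mon_deg_add: "mon_deg (m + m') = mon_deg m + mon_deg m'"
  by (simp add: mon_deg_def lookup_add sum.distrib)

lemma mon_deg_0 [simp]: "mon_deg 0 = 0"
  by (simp add: mon_deg_def)

lemma mon_deg_eq_0_iff: "mon_deg m = 0 \<longleftrightarrow> m = 0"
  by (auto simp: mon_deg_def intro: poly_mapping_eqI)

lemma homogeneous_0 [simp]: "homogeneous n 0"
  by (simp add: homogeneous_def)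

lemma homogeneous_add: "homogeneous n p \<Longrightarrow> homogeneous n q \<Longrightarrow> homogeneous n (p + q)"
  using keys_add[of p q] by (auto simp: homogeneous_def)

lemma homogeneous_uminus: "homogeneous n p \<Longrightarrow> homogeneous n (- p)"
  by (simp add: homogeneous_def in_keys_iff)

lemma homogeneous_sum: "(\<And>x. x \<in> A \<Longrightarrow> homogeneous n (g x)) \<Longrightarrow> homogeneous n (sum g A)"
  by (induction A rule: infinite_finite_induct) (auto intro: homogeneous_add)

lemma homogeneous_mult: "homogeneous a p \<Longrightarrow> homogeneous b q \<Longrightarrow> homogeneous (a + b) (p * q)"
  using keys_mult[of p q] by (fastforce simp: homogeneous_def mon_deg_add)

lemma homogeneous_mult_eq: "homogeneous a p \<Longrightarrow> homogeneous b q \<Longrightarrow> n = a + b \<Longrightarrow> homogeneous n (p * q)"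
  using homogeneous_mult by blast

lemma homogeneous_single: "homogeneous (int (mon_deg m)) (Poly_Mapping.single m c)"
  by (simp add: homogeneous_def)

lemma homogeneous_scalar_mult: "homogeneous n p \<Longrightarrow> homogeneous n (scalar_mult c p)"
  unfolding scalar_mult_def 
  by (rule homogeneous_mult_eq[of 0]) (use homogeneous_single[of 0 c] in auto)

lemma homogeneous_unique: "homogeneous a p \<Longrightarrow> homogeneous b p \<Longrightarrow> p \<noteq> 0 \<Longrightarrow> a = b"
  unfolding homogeneous_def by (metis keys_eq_empty ex_in_conv)

lemma homogeneous_neg: "homogeneous n p \<Longrightarrow> n < 0 \<Longrightarrow> p = 0"
  by (rule poly_mapping_eqI) (auto simp: homogeneous_def in_keys_iff)

lift_definition hom_component :: "int \<Rightarrow> 'k::field R \<Rightarrow> 'k R" is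
  "\<lambda>n f m. if int (mon_deg m) = n then f m else 0"
  by (rule finite_subset) auto

lemma lookup_hom_component: "Poly_Mapping.lookup (hom_component n p) m = (if int (mon_deg m) = n then Poly_Mapping.lookup p m else 0)"
  by transfer simp

lemma keys_hom_component: "Poly_Mapping.keys (hom_component n p) = {m \<in> Poly_Mapping.keys p. int (mon_deg m) = n}"
  by (auto simp: in_keys_iff lookup_hom_component split: if_splits)

lemma homogeneous_hom_component [simp]: "homogeneous n (hom_component n p)"
  by (simp add: homogeneous_def keys_hom_component)

lemma hom_component_id: "homogeneous n p \<Longrightarrow> hom_component n p = p"
  by (rule poly_mapping_eqI) (auto simp: lookup_hom_component homogeneous_def in_keys_iff)

lemma hom_component_eq_0: "(\<And>m. m \<in> Poly_Mapping.keys p \<Longrightarrow> int (mon_deg m) \<noteq> n) \<Longrightarrow> hom_component n p = 0"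
  by (rule poly_mapping_eqI) (auto simp: lookup_hom_component in_keys_iff)

lemma hom_component_0 [simp]: "hom_component n 0 = 0"
  by (rule hom_component_eq_0) simp

lemma hom_component_add: "hom_component n (p + q) = hom_component n p + hom_component n q"
  by (rule poly_mapping_eqI) (auto simp: lookup_hom_component lookup_add)

lemma hom_component_sum: "hom_component n (sum g A) = (\<Sum>x\<in>A. hom_component n (g x))"
  by (induction A rule: infinite_finite_induct) (auto simp: hom_component_add)

lemma hom_component_mult:
  assumes "homogeneous a q"
  shows "hom_component n (q * p) = q * hom_component (n - a) p"
proof -
  have "hom_component n (q * p) = hom_component n (q * hom_component (n - a) p) + hom_component n (q * (p - hom_component (n - a) p))"
    by (simp add: algebra_simps flip: hom_component_add)
  also have "hom_component n (q * hom_component (n - a) p) = q * hom_component (n - a) p"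
    using assms by (intro hom_component_id homogeneous_mult_eq[of a _ "n - a"]) auto
  also have "hom_component n (q * (p - hom_component (n - a) p)) = 0"
  proof (rule hom_component_eq_0)
    fix m assume "m \<in> Poly_Mapping.keys (q * (p - hom_component (n - a) p))"
    then obtain u v where uv: "m = u + v" "u \<in> Poly_Mapping.keys q" "v \<in> Poly_Mapping.keys (p - hom_component (n - a) p)"
      using keys_mult by blast
    then have "int (mon_deg v) \<noteq> n - a"
      by (auto simp: in_keys_iff lookup_minus lookup_hom_component)
    moreover have "int (mon_deg u) = a" using assms uv by (simp add: homogeneous_def)
    ultimately show "int (mon_deg m) \<noteq> n" using uv by (simp add: mon_deg_add)
  qed
  finally show ?thesis by simp
qed

text \<open>
  The factor \<open>\<sigma> = 1\<close> yields the components of highest degree and \<open>\<sigma> = -1\<close> those of lowest degree.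
\<close>

lemma hom_component_extreme_mult:
  fixes \<sigma> :: int
  assumes "\<And>m. m \<in> Poly_Mapping.keys p \<Longrightarrow> \<sigma> * int (mon_deg m) \<le> \<sigma> * a"
    and "\<And>m. m \<in> Poly_Mapping.keys q \<Longrightarrow> \<sigma> * int (mon_deg m) \<le> \<sigma> * b" and "\<sigma> \<noteq> 0"
  shows "hom_component (a + b) (p * q) = hom_component a p * hom_component b q"
proof -
  have "p * q = hom_component a p * q + (p - hom_component a p) * q" by (simp add: algebra_simps)
  then have "hom_component (a + b) (p * q) = hom_component (a + b) (hom_component a p * q) + hom_component (a + b) ((p - hom_component a p) * q)"
    by (simp only: hom_component_add)
  also have "hom_component (a + b) (hom_component a p * q) = hom_component a p * hom_component b q"
    by (subst hom_component_mult[of a]) auto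
  also have "hom_component (a + b) ((p - hom_component a p) * q) = 0"
  proof (rule hom_component_eq_0)
    fix m assume "m \<in> Poly_Mapping.keys ((p - hom_component a p) * q)"
    then obtain u v where uv: "m = u + v" "u \<in> Poly_Mapping.keys (p - hom_component a p)" "v \<in> Poly_Mapping.keys q"
      using keys_mult by blast
    then have "int (mon_deg u) \<noteq> a" "u \<in> Poly_Mapping.keys p"
      by (auto simp: in_keys_iff lookup_minus lookup_hom_component split: if_splits)
    then have "\<sigma> * int (mon_deg u) < \<sigma> * a" using assms by (metis mult_left_cancel order_le_imp_less_or_eq)
    moreover have "\<sigma> * int (mon_deg v) \<le> \<sigma> * b" using assms uv by simp
    ultimately have "\<sigma> * (int (mon_deg u) + int (mon_deg v)) < \<sigma> * (a + b)"
      unfolding distrib_left by linarith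
    then show "int (mon_deg m) \<noteq> a + b" using uv by (auto simp: mon_deg_add)
  qed
  finally show ?thesis by simp
qed

lemma hom_component_neq_0: "m \<in> Poly_Mapping.keys p \<Longrightarrow> hom_component (int (mon_deg m)) p \<noteq> 0"
  by (metis (mono_tags, lifting) keys_hom_component mem_Collect_eq keys_zero empty_iff)

text \<open>
  Highest and lowest degrees are both additive in products, so if they agree for the product then
  they agree for each factor.
\<close>

lemma homogeneous_factor:
  fixes p q :: "'k::field R"
  assumes pq: "homogeneous n (p * q)" "p * q \<noteq> 0"
  obtains a where "homogeneous a p"
proof -
  have p0: "Poly_Mapping.keys p \<noteq> {}" and q0: "Poly_Mapping.keys q \<noteq> {}"
    using pq(2) by (auto simp: keys_eq_empty)
  define U where "U = (\<lambda>m. int (mon_deg m)) ` Poly_Mapping.keys p"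
  define V where "V = (\<lambda>m. int (mon_deg m)) ` Poly_Mapping.keys q"
  have UV: "finite U" "U \<noteq> {}" "finite V" "V \<noteq> {}" using p0 q0 by (auto simp: U_def V_def)
  have eq: "a + b = n" if "a \<in> U" "b \<in> V" "\<sigma> \<noteq> 0" 
    "\<And>u. u \<in> U \<Longrightarrow> \<sigma> * u \<le> \<sigma> * a" "\<And>u. u \<in> V \<Longrightarrow> \<sigma> * u \<le> \<sigma> * b" for a b \<sigma>
  proof -
    have "hom_component (a + b) (p * q) = hom_component a p * hom_component b q"
      using that by (intro hom_component_extreme_mult[of _ \<sigma>]) (auto simp: U_def V_def)
    moreover have "hom_component a p \<noteq> 0" "hom_component b q \<noteq> 0"
      using that(1,2) hom_component_neq_0 by (auto simp: U_def V_def)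
    ultimately have "hom_component (a + b) (p * q) \<noteq> 0" by simp
    then show "a + b = n" using pq(1) by (metis hom_component_eq_0 homogeneous_def)
  qed
  have "Max U + Max V = n" using UV by (intro eq[of _ _ 1]) auto
  moreover have "Min U + Min V = n" using UV by (intro eq[of _ _ "-1"]) auto
  moreover have "Min U \<le> Max U" "Min V \<le> Max V" using UV by auto
  ultimately have "Min U = Max U" by linarith
  then have "u = Max U" if "u \<in> U" for u 
    using that UV by (metis Max_ge Min_le order_antisym)
  then have "homogeneous (Max U) p" by (auto simp: homogeneous_def U_def)
  then show ?thesis by (rule that)
qed

section \<open>Graded free modules and their Hilbert functions\<close>

text \<open>
  Vectors are functions on \<^typ>\<open>nat\<close> that vanish from some index on, so that free modules of all
  ranks lie in one vector space over the field.
\<close>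

definition fscale :: "'k::field \<Rightarrow> (nat \<Rightarrow> 'k R) \<Rightarrow> (nat \<Rightarrow> 'k R)" where
  "fscale c v = (\<lambda>i. scalar_mult c (v i))"

lemma vector_space_fscale: "vector_space (fscale :: 'k::field \<Rightarrow> _)"
proof -
  interpret vector_space "scalar_mult :: 'k \<Rightarrow> _" by (rule vector_space_scalar_mult)
  show ?thesis
    by standard (simp_all add: fscale_def fun_eq_iff scale_right_distrib scale_left_distrib)
qed

interpretation fs: vector_space_pair "fscale :: 'k::field \<Rightarrow> _" "fscale :: 'k::field \<Rightarrow> _"
  by (simp add: vector_space_pair_def vector_space_fscale)

abbreviation graded_dim :: "(nat \<Rightarrow> 'k::field R) set \<Rightarrow> nat" where
  "graded_dim \<equiv> vector_space.dim fscale"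

lemma lookup_scalar_mult: "Poly_Mapping.lookup (scalar_mult c p) m = c * Poly_Mapping.lookup p m"
  unfolding scalar_mult_def mult_map_scale_conv_mult[symmetric]
  by (simp add: map.rep_eq when_def)

lemma sum_fun_apply: "(\<Sum>x\<in>A. (g x :: 'a \<Rightarrow> 'b::comm_monoid_add)) i = (\<Sum>x\<in>A. g x i)"
  by (induction A rule: infinite_finite_induct) simp_all

text \<open>
  The Hilbert function of \<open>R\<close>.
\<close>

definition monomial_count :: "int \<Rightarrow> nat" where
  "monomial_count n = card {m :: 3 \<Rightarrow>\<^sub>0 nat. int (mon_deg m) = n}"

definition mk_mon :: "nat \<times> nat \<times> nat \<Rightarrow> (3 \<Rightarrow>\<^sub>0 nat)" where
  "mk_mon = (\<lambda>(a, b, c). Poly_Mapping.single 0 a + Poly_Mapping.single 1 b + Poly_Mapping.single 2 c)"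

lemma lookup_mk_mon: "Poly_Mapping.lookup (mk_mon (a, b, c)) 0 = a"
  "Poly_Mapping.lookup (mk_mon (a, b, c)) 1 = b" "Poly_Mapping.lookup (mk_mon (a, b, c)) 2 = c"
  using distinct_type_3 by (simp_all add: mk_mon_def lookup_add lookup_single when_def)

lemma mk_mon_lookup: "mk_mon (Poly_Mapping.lookup m 0, Poly_Mapping.lookup m 1, Poly_Mapping.lookup m 2) = m"
proof (rule poly_mapping_eqI)
  fix k
  show "Poly_Mapping.lookup (mk_mon (Poly_Mapping.lookup m 0, Poly_Mapping.lookup m 1, Poly_Mapping.lookup m 2)) k
    = Poly_Mapping.lookup m k"
    using exhaust_type_3[of k] by (elim disjE) (simp_all only: lookup_mk_mon)
qed

lemma mon_deg_set_eq: "{m. mon_deg m = n} = (\<lambda>(a, b). mk_mon (a, b, n - a - b)) ` (SIGMA a:{..n}. {..n - a})"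
proof (intro Set.set_eqI iffI)
  fix m assume "m \<in> {m. mon_deg m = n}"
  then have "Poly_Mapping.lookup m 0 + Poly_Mapping.lookup m 1 + Poly_Mapping.lookup m 2 = n"
    by (simp add: mon_deg_eq)
  then show "m \<in> (\<lambda>(a, b). mk_mon (a, b, n - a - b)) ` (SIGMA a:{..n}. {..n - a})"
    by (intro image_eqI[where x = "(Poly_Mapping.lookup m 0, Poly_Mapping.lookup m 1)"])
      (use mk_mon_lookup[of m] in auto)
qed (auto simp: mon_deg_eq lookup_mk_mon)

lemma finite_mon_deg: "finite {m. int (mon_deg m) = n}"
proof -
  have "{m. int (mon_deg m) = n} \<subseteq> {m. mon_deg m = nat n}" by auto
  moreover have "finite {m. mon_deg m = nat n}" unfolding mon_deg_set_eq by simp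
  ultimately show ?thesis by (rule finite_subset)
qed

lemma monomial_count_neg: "n < 0 \<Longrightarrow> monomial_count n = 0"
  by (auto simp: monomial_count_def)

text \<open>
  The Hilbert function agrees with its polynomial from \<open>-2\<close> on, as \<open>-1\<close> and \<open>-2\<close> are roots.
\<close>

lemma monomial_count_eq: "2 * int (monomial_count n) = (n + 1) * (n + 2)" if "n \<ge> -2"
proof (cases "n \<ge> 0")
  case True
  then obtain k where k: "n = int k" using nonneg_int_cases by blast
  have "monomial_count n = card ((\<lambda>(a, b). mk_mon (a, b, k - a - b)) ` (SIGMA a:{..k}. {..k - a}))"
    unfolding mon_deg_set_eq[symmetric] by (simp add: monomial_count_def k)
  also have "\<dots> = card (SIGMA a:{..k}. {..k - a})"
  proof (rule card_image, rule inj_onI, clarify)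
    fix a b a' b' assume e: "mk_mon (a, b, k - a - b) = mk_mon (a', b', k - a' - b')"
    show "a = a' \<and> b = b'"
      using arg_cong[OF e, of "\<lambda>m. Poly_Mapping.lookup m 0"] arg_cong[OF e, of "\<lambda>m. Poly_Mapping.lookup m 1"]
      by (simp only: lookup_mk_mon)
  qed
  also have "\<dots> = (\<Sum>a\<le>k. Suc (k - a))" by (simp add: card_SigmaI)
  also have "\<dots> = (\<Sum>a\<le>k. Suc a)" by (rule sum.reindex_bij_witness[of _ "\<lambda>a. k - a" "\<lambda>a. k - a"]) auto
  finally have "monomial_count n = (\<Sum>a\<le>k. Suc a)" .
  moreover have "2 * (\<Sum>a\<le>k. Suc a) = (k + 1) * (k + 2)" by (induction k) auto
  ultimately have "2 * monomial_count n = (k + 1) * (k + 2)" by simp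
  then have "2 * int (monomial_count n) = (int k + 1) * (int k + 2)" 
    by (metis (mono_tags, lifting) of_nat_1 of_nat_add of_nat_mult of_nat_numeral)
  then show ?thesis by (simp add: k)
next
  case False
  then have "n = -1 \<or> n = -2" using that by auto
  then show ?thesis using monomial_count_neg[of n] by auto
qed

text \<open>
  The degree \<open>n\<close> part of \<open>R(-a\<^sub>0) \<oplus> \<dots> \<oplus> R(-a\<^sub>s\<^sub>-\<^sub>1)\<close>.
\<close>

definition graded_vecs :: "nat \<Rightarrow> (nat \<Rightarrow> int) \<Rightarrow> int \<Rightarrow> (nat \<Rightarrow> 'k::field R) set" where
  "graded_vecs s a n = {v. (\<forall>i<s. homogeneous (n - a i) (v i)) \<and> (\<forall>i\<ge>s. v i = 0)}"

lemma graded_vecsD: "v \<in> graded_vecs s a n \<Longrightarrow> i < s \<Longrightarrow> homogeneous (n - a i) (v i)"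
  by (simp add: graded_vecs_def)

lemma graded_vecs_outside: "v \<in> graded_vecs s a n \<Longrightarrow> \<not> i < s \<Longrightarrow> v i = 0"
  by (simp add: graded_vecs_def)

lemma graded_vecsI: "(\<And>i. i < s \<Longrightarrow> homogeneous (n - a i) (v i)) \<Longrightarrow> (\<And>i. i \<ge> s \<Longrightarrow> v i = 0)
  \<Longrightarrow> v \<in> graded_vecs s a n"
  by (simp add: graded_vecs_def)

lemma subspace_graded_vecs: "fs.vs1.subspace (graded_vecs s a n)"
  by (auto simp: fs.vs1.subspace_def graded_vecs_def fscale_def homogeneous_add homogeneous_scalar_mult)
    (simp add: scalar_mult_def)

text \<open>
  The basis consists of the unit vectors multiplied by monomials of the appropriate degree.
\<close>

lemma graded_vecs_basis:
  fixes a :: "nat \<Rightarrow> int" and n :: int and s :: nat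
  defines "X \<equiv> (SIGMA i:{..<s}. {m :: 3 \<Rightarrow>\<^sub>0 nat. int (mon_deg m) = n - a i})"
  defines "b \<equiv> (\<lambda>(i, m) j. if j = i then Poly_Mapping.single m 1 else (0 :: 'k::field R))"
  shows "finite (b ` X)" "b ` X \<subseteq> graded_vecs s a n" "graded_vecs s a n \<subseteq> fs.vs1.span (b ` X)"
    "fs.vs1.independent (b ` X)" "card (b ` X) = (\<Sum>i<s. monomial_count (n - a i))"
proof -
  have fX: "finite X" unfolding X_def using finite_mon_deg by auto
  then show "finite (b ` X)" by simp
  have inj: "inj_on b X"
  proof (rule inj_onI, clarify)
    fix i m i' m' assume e: "b (i, m) = b (i', m')"
    have "b (i, m) i = b (i', m') i" by (simp add: e)
    then have "Poly_Mapping.lookup (b (i, m) i) m = Poly_Mapping.lookup (b (i', m') i) m" by simp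
    then have "i = i'" by (auto simp: b_def split: if_splits)
    moreover have "Poly_Mapping.keys (b (i, m) i) = Poly_Mapping.keys (b (i', m') i)"
      by (rule arg_cong[OF fun_cong[OF e]])
    ultimately show "i = i' \<and> m = m'" by (simp add: b_def)
  qed
  show "card (b ` X) = (\<Sum>i<s. monomial_count (n - a i))"
    using inj by (simp add: card_image X_def monomial_count_def finite_mon_deg card_SigmaI)
  show "b ` X \<subseteq> graded_vecs s a n"
    by (auto simp: graded_vecs_def b_def X_def) (metis homogeneous_single)
  have eval: "Poly_Mapping.lookup ((\<Sum>y\<in>X. fscale (c y) (b y)) i) m = (if (i, m) \<in> X then c (i, m) else 0)" for c i m
  proof -
    have "Poly_Mapping.lookup ((\<Sum>y\<in>X. fscale (c y) (b y)) i) m = (\<Sum>y\<in>X. if y = (i, m) then c (i, m) else 0)"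
      unfolding sum_fun_apply lookup_sum fscale_def lookup_scalar_mult
      by (rule sum.cong) (auto simp: b_def lookup_single when_def split: if_splits)
    then show ?thesis using fX by simp
  qed
  show "fs.vs1.independent (b ` X)"
  proof (rule fs.vs1.independent_if_scalars_zero)
    show "finite (b ` X)" using fX by simp
    fix f x assume z: "(\<Sum>x\<in>b ` X. fscale (f x) x) = 0" and "x \<in> b ` X"
    then obtain i m where x: "x = b (i, m)" "(i, m) \<in> X" by auto
    have "(\<Sum>y\<in>X. fscale (f (b y)) (b y)) = 0" using z by (simp add: sum.reindex[OF inj])
    then show "f x = 0" using eval[of "\<lambda>y. f (b y)" i m] x by simp
  qed
  show "graded_vecs s a n \<subseteq> fs.vs1.span (b ` X)"
  proof
    fix v :: "nat \<Rightarrow> 'k R" assume v: "v \<in> graded_vecs s a n"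
    have "v = (\<Sum>y\<in>X. fscale (Poly_Mapping.lookup (v (fst y)) (snd y)) (b y))"
    proof (intro ext poly_mapping_eqI)
      fix i m
      have "Poly_Mapping.lookup (v i) m = 0" if "(i, m) \<notin> X"
        using that v by (cases "i < s") (auto simp: X_def graded_vecs_def homogeneous_def not_in_keys_iff_lookup_eq_zero[symmetric])
      then show "Poly_Mapping.lookup (v i) m = Poly_Mapping.lookup ((\<Sum>y\<in>X. fscale (Poly_Mapping.lookup (v (fst y)) (snd y)) (b y)) i) m"
        using eval[of "\<lambda>y. Poly_Mapping.lookup (v (fst y)) (snd y)" i m] by simp
    qed
    also have "\<dots> \<in> fs.vs1.span (b ` X)"
      by (intro fs.vs1.span_sum fs.vs1.span_scale fs.vs1.span_base) auto
    finally show "v \<in> fs.vs1.span (b ` X)" .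
  qed
qed

lemma graded_dim_graded_vecs: "graded_dim (graded_vecs s a n :: (nat \<Rightarrow> 'k::field R) set) = (\<Sum>i<s. monomial_count (n - a i))"
  by (subst fs.vs1.basis_card_eq_dim[OF graded_vecs_basis(2,3,4), symmetric]) (rule graded_vecs_basis(5))

lemma graded_dim_mono:
  assumes "S \<subseteq> T" "T \<subseteq> graded_vecs s a n"
  shows "graded_dim S \<le> graded_dim T"
  using fs.vs1.dim_mono_finite[OF assms(1) order_trans[OF assms(2) graded_vecs_basis(3)] graded_vecs_basis(1)] .

lemma subspace_eq_graded:
  fixes S :: "(nat \<Rightarrow> 'k::field R) set"
  assumes "fs.vs1.subspace S" "S \<subseteq> graded_vecs s a n" "graded_dim (graded_vecs s a n :: (nat \<Rightarrow> 'k::field R) set) \<le> graded_dim S"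
  shows "S = graded_vecs s a n"
  using fs.vs1.subspace_eq_of_dim_le[OF assms(1,2) graded_vecs_basis(3,1) assms(3)] .

lemma graded_rank_nullity:
  assumes f: "Vector_Spaces.linear fscale fscale f" and S: "fs.vs1.subspace S" "S \<subseteq> graded_vecs s a n"
  shows "graded_dim S = graded_dim {x \<in> S. f x = 0} + graded_dim (f ` S)"
  using fs.rank_nullity[OF f S(1) order_trans[OF S(2) graded_vecs_basis(3)] graded_vecs_basis(1)] .

definition mat_app :: "nat \<Rightarrow> nat \<Rightarrow> (nat \<Rightarrow> nat \<Rightarrow> 'k::field R) \<Rightarrow> (nat \<Rightarrow> 'k R) \<Rightarrow> (nat \<Rightarrow> 'k R)" where
  "mat_app t s A v = (\<lambda>i. if i < t then \<Sum>j<s. A i j * v j else 0)"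

lemma linear_mat_app: "Vector_Spaces.linear fscale fscale (mat_app t s A)"
  unfolding Vector_Spaces.linear_iff
  by (auto simp: vector_space_fscale mat_app_def fscale_def scalar_mult_def fun_eq_iff sum.distrib sum_distrib_left algebra_simps)

definition graded_mat :: "nat \<Rightarrow> (nat \<Rightarrow> int) \<Rightarrow> nat \<Rightarrow> (nat \<Rightarrow> int) \<Rightarrow> (nat \<Rightarrow> nat \<Rightarrow> 'k::field R) \<Rightarrow> bool" where
  "graded_mat t a s b A \<longleftrightarrow> (\<forall>i<t. \<forall>j<s. homogeneous (b j - a i) (A i j))"

lemma graded_mat_transpose: "graded_mat t a s b A \<Longrightarrow> graded_mat s (\<lambda>i. - b i) t (\<lambda>i. - a i) (\<lambda>i j. A j i)"
  by (simp add: graded_mat_def)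

lemma mat_app_graded:
  assumes "graded_mat t a s b A" "v \<in> graded_vecs s b n"
  shows "mat_app t s A v \<in> graded_vecs t a n"
  unfolding mat_app_def
proof (rule graded_vecsI)
  fix i assume i: "i < t"
  have "homogeneous (n - a i) (\<Sum>j<s. A i j * v j)"
    using assms i by (intro homogeneous_sum homogeneous_mult_eq[where a = "b j - a i" and b = "n - b j" for j])
      (auto simp: graded_mat_def graded_vecs_def)
  then show "homogeneous (n - a i) (if i < t then \<Sum>j<s. A i j * v j else 0)" using i by simp
qed simp

definition vec_component :: "nat \<Rightarrow> (nat \<Rightarrow> int) \<Rightarrow> int \<Rightarrow> (nat \<Rightarrow> 'k::field R) \<Rightarrow> (nat \<Rightarrow> 'k R)" where
  "vec_component s a n v = (\<lambda>i. if i < s then hom_component (n - a i) (v i) else 0)"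

lemma vec_component_graded: "vec_component s a n v \<in> graded_vecs s a n"
  by (simp add: graded_vecs_def vec_component_def)

lemma vec_component_id: "v \<in> graded_vecs s a n \<Longrightarrow> vec_component s a n v = v"
  by (auto simp: vec_component_def graded_vecs_def fun_eq_iff hom_component_id)

text \<open>
  By this, every solution of a graded linear system with homogeneous right-hand side can be replaced
  by a homogeneous one.
\<close>

lemma mat_app_vec_component:
  assumes "graded_mat t a s b A"
  shows "mat_app t s A (vec_component s b n v) = vec_component t a n (mat_app t s A v)"
proof
  fix i
  show "mat_app t s A (vec_component s b n v) i = vec_component t a n (mat_app t s A v) i"
  proof (cases "i < t")
    case True
    have "hom_component (n - a i) (A i j * v j) = A i j * hom_component (n - b j) (v j)" if "j < s" for j
      using assms True that hom_component_mult[of "b j - a i" "A i j" "n - a i" "v j"] by (simp add: graded_mat_def)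
    then show ?thesis using True by (simp add: mat_app_def vec_component_def hom_component_sum)
  qed (simp add: mat_app_def vec_component_def)
qed

section \<open>Codimension two and common divisors\<close>

definition total_degree :: "'k::field R \<Rightarrow> nat" where
  "total_degree p = Max (mon_deg ` Poly_Mapping.keys p)"

lemma total_degree_mult_ge:
  assumes "p \<noteq> 0" "q \<noteq> (0 :: 'k::field R)"
  shows "total_degree p + total_degree q \<le> total_degree (p * q)"
proof -
  have ex: "\<exists>m\<in>Poly_Mapping.keys p. mon_deg m = total_degree p" if "p \<noteq> 0" for p :: "'k R"
  proof -
    have "total_degree p \<in> mon_deg ` Poly_Mapping.keys p" unfolding total_degree_def by (rule Max_in) (use that in auto)
    then show ?thesis by (metis imageE)
  qed
  have le: "mon_deg m \<le> total_degree p" if "m \<in> Poly_Mapping.keys p" for m and p :: "'k R"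
    using that unfolding total_degree_def by simp
  have "hom_component (int (total_degree p) + int (total_degree q)) (p * q) = hom_component (int (total_degree p)) p * hom_component (int (total_degree q)) q"
    by (rule hom_component_extreme_mult[of _ 1]) (auto simp: le)
  moreover have "hom_component (int (total_degree p)) p \<noteq> 0" "hom_component (int (total_degree q)) q \<noteq> 0"
    using ex[OF assms(1)] ex[OF assms(2)] hom_component_neq_0 by metis+
  ultimately have "hom_component (int (total_degree p) + int (total_degree q)) (p * q) \<noteq> 0" by simp
  then obtain m where "m \<in> Poly_Mapping.keys (p * q)" "int (mon_deg m) = int (total_degree p) + int (total_degree q)"
    using hom_component_eq_0[of "p * q"] by blast
  then show ?thesis using le[of m "p * q"] by linarith
qed

lemma total_degree_nonunit:
  assumes "p \<noteq> 0" "\<not> p dvd (1 :: 'k::field R)"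
  shows "0 < total_degree p"
proof (rule ccontr)
  assume "\<not> 0 < total_degree p"
  then have "mon_deg m = 0" if "m \<in> Poly_Mapping.keys p" for m
    using that Max_ge[of "mon_deg ` Poly_Mapping.keys p" "mon_deg m"] unfolding total_degree_def by auto
  then have "Poly_Mapping.keys p \<subseteq> {0}" by (auto simp: mon_deg_eq_0_iff)
  then have p: "p = Poly_Mapping.single 0 (Poly_Mapping.lookup p 0)"
    by (intro poly_mapping_eqI) (auto simp: lookup_single when_def in_keys_iff)
  then have "Poly_Mapping.lookup p 0 \<noteq> 0" using assms(1) by (metis single_zero)
  then have "p * Poly_Mapping.single 0 (inverse (Poly_Mapping.lookup p 0)) = 1"
    by (subst p) (simp add: mult_single)
  then show False using assms(2) by (metis dvdI)
qed

text \<open>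
  A prime ideal strictly inside \<open>p R\<close> does not contain \<open>p\<close>, so it is stable under division by \<open>p\<close>.
  Division by \<open>p\<close> lowers the total degree, hence such an ideal is zero.
\<close>

lemma height_principal_prime_le:
  fixes p :: "'k::field R"
  assumes p: "prime_elem p"
  shows "height {x. p dvd x} \<le> 1"
  unfolding height_def
proof (rule Sup_least, clarify)
  fix n and C :: "nat \<Rightarrow> 'k R set"
  assume C: "\<forall>i\<le>n. is_prime_ideal (C i)" "\<forall>i<n. C i \<subset> C (Suc i)" "C n = {x. p dvd x}"
  show "enat n \<le> 1"
  proof (rule ccontr)
    assume "\<not> enat n \<le> 1"
    then have "1 < enat n" by (simp add: not_le)
    then have n: "n \<ge> 2" by (simp add: one_enat_def)
    then obtain k where k: "n = Suc (Suc k)" by (metis add_2_eq_Suc le_Suc_ex)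
    let ?Q = "C (Suc k)"
    have Q: "is_prime_ideal ?Q" "?Q \<subset> {x. p dvd x}" using C k by auto
    have sub: "is_ideal ?Q" "is_ideal (C k)" using C(1) k by (auto simp: is_prime_ideal_def)
    have pQ: "p \<notin> ?Q"
    proof
      assume "p \<in> ?Q"
      then have "c * p \<in> ?Q" for c using module.subspace_scale[OF module_times sub(1)] by blast
      then have "{x. p dvd x} \<subseteq> ?Q" by (auto simp: dvd_def mult.commute)
      then show False using Q(2) by blast
    qed
    have "x = 0" if "x \<in> ?Q" for x
      using that
    proof (induction "total_degree x" arbitrary: x rule: less_induct)
      case less
      then obtain y where y: "x = p * y" using Q(2) by blast
      have yQ: "y \<in> ?Q" using Q(1) less.prems pQ unfolding y is_prime_ideal_def by blast
      show "x = 0"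
      proof (rule ccontr)
        assume "x \<noteq> 0"
        then have "y \<noteq> 0" using y by auto
        have "total_degree p + total_degree y \<le> total_degree x" unfolding y
          using p \<open>y \<noteq> 0\<close> by (intro total_degree_mult_ge) (auto simp: prime_elem_def)
        moreover have "0 < total_degree p" using p by (intro total_degree_nonunit) (auto simp: prime_elem_def)
        ultimately have "total_degree y < total_degree x" by linarith
        then have "y = 0" using yQ by (rule less.hyps)
        then show False using \<open>y \<noteq> 0\<close> by simp
      qed
    qed
    moreover have "0 \<in> C k" using module.subspace_0[OF module_times sub(2)] .
    moreover have "C k \<subset> ?Q" using C(2) k by auto
    ultimately show False by blast
  qed
qed

lemma is_prime_ideal_principal:
  fixes p :: "'k::field R"
  assumes p: "prime_elem p"
  shows "is_prime_ideal {x. p dvd x}"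
  unfolding is_prime_ideal_def module.subspace_def[OF module_times]
proof (intro conjI ballI allI impI)
  show "{x. p dvd x} \<noteq> UNIV" 
  proof
    assume "{x. p dvd x} = UNIV"
    then have "p dvd 1" by auto
    then show False using prime_elem_not_unit[OF p] by blast
  qed
  fix a b assume "a * b \<in> {x. p dvd x}"
  then have "p dvd a \<or> p dvd b" using prime_elem_dvd_multD[OF p] by blast
  then show "a \<in> {x. p dvd x} \<or> b \<in> {x. p dvd x}" by blast
next
  fix a b :: "'k R" assume "a \<in> {x. p dvd x}" "b \<in> {x. p dvd x}"
  then show "a + b \<in> {x. p dvd x}" by (auto intro: dvd_add)
next
  fix c a :: "'k R" assume "a \<in> {x. p dvd x}"
  then show "c * a \<in> {x. p dvd x}" by (auto intro: dvd_mult)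
qed simp

text \<open>
  What is left of \<open>q\<close> after removing its common divisor with \<open>h\<close> divides every element of \<open>F\<close>.  If it
  were not a unit, then one of its prime factors would generate a prime ideal of height at most one
  containing \<open>I\<close>.
\<close>

lemma codim_2_grade:
  fixes I :: "'k::field R set"
  assumes codim: "codim I = 2" and q: "q \<noteq> 0" "\<And>x. x \<in> F \<Longrightarrow> q dvd x * h" and I: "I = ideal_of F"
  shows "q dvd h"
proof -
  obtain g P Q where gPQ: "q = g * P" "h = g * Q" and cop: "\<And>x. P dvd Q * x \<Longrightarrow> P dvd x"
    using gcd_split[OF q(1)] by metis
  have nz: "g \<noteq> 0" "P \<noteq> 0" using q gPQ by auto
  have P: "P dvd x" if "x \<in> F" for x
  proof -
    have "g * P dvd g * (Q * x)" using q(2)[OF that] unfolding gPQ by (simp add: algebra_simps)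
    then have "P dvd Q * x" using nz(1) dvd_times_left_cancel_iff by blast
    then show ?thesis by (rule cop)
  qed
  have "P dvd 1"
  proof (rule ccontr)
    assume "\<not> P dvd 1"
    then obtain p where p: "prime_elem p" "p dvd P" using prime_divisor_ex nz by metis
    have "F \<subseteq> {x. p dvd x}" using P p(2) dvd_trans by blast
    then have "I \<subseteq> {x. p dvd x}" unfolding I
      using is_prime_ideal_principal[OF p(1)] module.span_minimal[OF module_times]
      unfolding is_prime_ideal_def by metis
    then have "codim I \<le> height {x. p dvd x}"
      unfolding codim_def using is_prime_ideal_principal[OF p(1)] by (intro INF_lower) auto
    also have "\<dots> \<le> 1" by (rule height_principal_prime_le[OF p(1)])
    finally show False unfolding codim by simp
  qed
  then show ?thesis unfolding gPQ by (metis dvd_mult_left dvd_triv_left mult_dvd_mono dvd_refl unit_imp_dvd dvd_trans one_dvd)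
qed

section \<open>The sum of the degrees\<close>

text \<open>
  Minimality of the resolution says that all entries have constant coefficient zero.  Contradictions
  to it come from evaluating identities at the constant coefficient, which is a ring homomorphism.
\<close>

lemma lookup_mult_0: "Poly_Mapping.lookup (p * q) 0 = Poly_Mapping.lookup p 0 * Poly_Mapping.lookup (q :: 'k::field R) 0"
  using coeff_nested[of "p * q" 0] coeff_nested[of p 0] coeff_nested[of q 0]
  by (simp add: nested_mult coeff_mult_0)

lemma lookup_sum_mult_0:
  assumes "\<And>i. i \<in> A \<Longrightarrow> Poly_Mapping.lookup (F i :: 'k::field R) 0 = 0"
  shows "Poly_Mapping.lookup (\<Sum>i\<in>A. F i * w i) 0 = 0"
  using assms by (simp add: lookup_sum lookup_mult_0)

lemma sum_3: "(\<Sum>a<3::nat. F a) = F 0 + F 1 + (F 2 :: 'a::comm_monoid_add)"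
  by (simp add: numeral_3_eq_3 numeral_2_eq_2)

lemma all_less_3: "(\<forall>a<3::nat. P a) \<longleftrightarrow> P 0 \<and> P 1 \<and> P 2"
  by (auto simp: numeral_3_eq_3 numeral_2_eq_2 less_Suc_eq)

lemma graded_dim_zero: "graded_dim {0} = 0"
  using fs.vs1.dim_le_card[of "{0}" "{}"] by simp

lemma graded_dim_image_inj:
  assumes f: "Vector_Spaces.linear fscale fscale f" and S: "fs.vs1.subspace S" "S \<subseteq> graded_vecs s a n"
    and inj: "\<And>x. x \<in> S \<Longrightarrow> f x = 0 \<Longrightarrow> x = 0"
  shows "graded_dim (f ` S) = graded_dim S"
proof -
  have "{x \<in> S. f x = 0} = {0}"
    using inj S(1) fs.vs1.subspace_0 fs.linear_0[OF f] by auto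
  then show ?thesis using graded_rank_nullity[OF f S] by (simp add: graded_dim_zero)
qed

lemma graded_dim_image_le:
  assumes "Vector_Spaces.linear fscale fscale f" "fs.vs1.subspace S" "S \<subseteq> graded_vecs s a n"
  shows "graded_dim (f ` S) \<le> graded_dim S"
  using graded_rank_nullity[OF assms] by simp

text \<open>
  Comparison of the linear coefficients of quadratic polynomials with equal leading coefficients.
\<close>

lemma vanishing_of_bounded_multiples:
  fixes X :: int
  assumes "\<And>n. n \<ge> N \<Longrightarrow> (2 * n + 3) * X \<le> C" "\<And>n. n \<ge> N \<Longrightarrow> C' \<le> (2 * n + 3) * X"
  shows "X = 0"
proof (rule ccontr)
  assume "X \<noteq> 0"
  define n where "n = max N 0 + \<bar>C\<bar> + \<bar>C'\<bar>"
  have n: "n \<ge> N" "2 * n + 3 > \<bar>C\<bar>" "2 * n + 3 > \<bar>C'\<bar>" by (auto simp: n_def)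
  show False
  proof (cases "X > 0")
    case True
    then have "(2 * n + 3) * 1 \<le> (2 * n + 3) * X" using n by (intro mult_left_mono) auto
    also have "\<dots> \<le> C" by (rule assms(1)[OF n(1)])
    finally show False using n by simp
  next
    case False
    have "C' \<le> (2 * n + 3) * X" by (rule assms(2)[OF n(1)])
    also have "\<dots> \<le> (2 * n + 3) * (-1)" using n False \<open>X \<noteq> 0\<close> by (intro mult_left_mono) auto
    finally show False using n by simp
  qed
qed

lemma sum_monomial_count:
  assumes "\<And>i. i < s \<Longrightarrow> n - a i \<ge> -2"
  shows "2 * int (\<Sum>i<s. monomial_count (n - a i)) = int s * (n^2 + 3 * n + 2) - (2 * n + 3) * (\<Sum>i<s. a i) + (\<Sum>i<s. (a i)^2)"
proof -
  have "2 * int (\<Sum>i<s. monomial_count (n - a i)) = (\<Sum>i<s. (n - a i + 1) * (n - a i + 2))"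
    using assms by (simp add: sum_distrib_left monomial_count_eq)
  also have "\<dots> = (\<Sum>i<s. (n^2 + 3 * n + 2) - (2 * n + 3) * a i + (a i)^2)"
    by (rule sum.cong) (simp_all add: power2_eq_square algebra_simps)
  also have "\<dots> = int s * (n^2 + 3 * n + 2) - (2 * n + 3) * (\<Sum>i<s. a i) + (\<Sum>i<s. (a i)^2)"
    by (simp add: sum.distrib sum_subtractf sum_distrib_left)
  finally show ?thesis .
qed

text \<open>
  The resolution in coordinates: \<open>f\<close> is the row of the three forms, and \<open>V\<close> and \<open>W\<close> are the matrices
  of the two following maps, with entries indexed by natural numbers below \<open>3\<close>, \<open>r\<close> and \<open>t\<close>.  The
  assumption \<open>grade\<close> is the trace that the codimension leaves.
\<close>

locale three_form_resolution =
  fixes f :: "nat \<Rightarrow> 'k::field R" and V W :: "nat \<Rightarrow> nat \<Rightarrow> 'k R"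
    and d r t :: nat and ds Ds :: "nat \<Rightarrow> int"
  assumes hom_f: "a < 3 \<Longrightarrow> homogeneous (int d) (f a)"
    and hom_V: "graded_mat 3 (\<lambda>_. int d) r ds V"
    and hom_W: "graded_mat r ds t Ds W"
    and fV: "i < r \<Longrightarrow> (\<Sum>a<3. f a * V a i) = 0"
    and VW: "a < 3 \<Longrightarrow> j < t \<Longrightarrow> (\<Sum>i<r. V a i * W i j) = 0"
    and exact1: "(\<Sum>a<3. f a * z a) = 0 \<Longrightarrow> \<exists>w. \<forall>a<3. z a = (\<Sum>i<r. V a i * w i)"
    and exact2: "\<forall>a<3. (\<Sum>i<r. V a i * w i) = 0 \<Longrightarrow> \<exists>x. \<forall>i<r. w i = (\<Sum>j<t. W i j * x j)"
    and exact3: "\<forall>i<r. (\<Sum>j<t. W i j * x j) = 0 \<Longrightarrow> \<forall>j<t. x j = 0"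
    and min_V: "a < 3 \<Longrightarrow> i < r \<Longrightarrow> Poly_Mapping.lookup (V a i) 0 = 0"
    and min_W: "i < r \<Longrightarrow> j < t \<Longrightarrow> Poly_Mapping.lookup (W i j) 0 = 0"
    and grade: "q \<noteq> 0 \<Longrightarrow> \<forall>a<3. q dvd f a * h \<Longrightarrow> q dvd h"
    and rank: "r = t + 2"
begin

text \<open>
  If a form were zero, then a unit vector would be a syzygy, although all syzygies are combinations
  of columns of \<open>V\<close> and so have entries without constant coefficient.
\<close>

lemma f_nonzero:
  assumes "a < 3" shows "f a \<noteq> 0"
proof
  assume "f a = 0"
  then have "(\<Sum>b<3. f b * (if b = a then 1 else 0)) = 0" by (intro sum.neutral) auto
  from exact1[OF this] obtain w where "\<forall>b<3. (if b = a then 1 else 0) = (\<Sum>i<r. V b i * w i)" by blast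
  with assms have "1 = (\<Sum>i<r. V a i * w i)" by auto
  then have "Poly_Mapping.lookup (1 :: 'k R) 0 = 0"
    using lookup_sum_mult_0[of "{..<r}" "V a" w] min_V assms by simp
  then show False by simp
qed

text \<open>
  The degree \<open>n\<close> part of the first syzygy module \<open>ker f\<close>.
\<close>

definition syzygies :: "int \<Rightarrow> (nat \<Rightarrow> 'k R) set" where
  "syzygies n = {z \<in> graded_vecs 3 (\<lambda>_. int d) n. (\<Sum>a<3. f a * z a) = 0}"

lemma syzygies_eq: "syzygies n = {z \<in> graded_vecs 3 (\<lambda>_. int d) n. mat_app 1 3 (\<lambda>_. f) z = 0}"
  by (auto simp: syzygies_def mat_app_def fun_eq_iff)

lemma subspace_syzygies: "fs.vs1.subspace (syzygies n)"
  unfolding syzygies_eq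
  using fs.vs1.subspace_inter[OF subspace_graded_vecs fs.linear_subspace_kernel[OF linear_mat_app]]
  by (simp add: Int_def)

lemma f_mat_app_V: "(\<Sum>a<3. f a * mat_app 3 r V w a) = 0"
proof -
  have "(\<Sum>a<3. f a * mat_app 3 r V w a) = (\<Sum>i<r. (\<Sum>a<3. f a * V a i) * w i)"
    unfolding mat_app_def sum_distrib_left sum_distrib_right
    by (subst sum.swap) (simp add: mult.assoc sum_distrib_left)
  then show ?thesis using fV by simp
qed

lemma mat_app_V_W: "mat_app 3 r V (mat_app r t W x) = 0"
proof
  fix a
  have "mat_app 3 r V (mat_app r t W x) a = (\<Sum>j<t. (\<Sum>i<r. V a i * W i j) * x j)" if "a < 3"
    unfolding mat_app_def sum_distrib_left sum_distrib_right using that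
    by (subst sum.swap) (simp add: mult.assoc sum_distrib_left)
  then show "mat_app 3 r V (mat_app r t W x) a = 0 a" using VW by (cases "a < 3") (auto simp: mat_app_def)
qed

lemma syzygies_lift:
  assumes "z \<in> syzygies n"
  obtains w where "w \<in> graded_vecs r ds n" "z = mat_app 3 r V w"
proof -
  obtain w where w: "\<forall>a<3. z a = (\<Sum>i<r. V a i * w i)" using exact1 assms by (auto simp: syzygies_def)
  have z: "z \<in> graded_vecs 3 (\<lambda>_. int d) n" using assms by (simp add: syzygies_def)
  then have "z = mat_app 3 r V w" using w by (auto simp: mat_app_def graded_vecs_def fun_eq_iff)
  then have "mat_app 3 r V (vec_component r ds n w) = z"
    using mat_app_vec_component[OF hom_V, of n w] vec_component_id[OF z] by simp
  with that show ?thesis using vec_component_graded by metis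
qed

lemma V_kernel_lift:
  assumes "w \<in> graded_vecs r ds n" "mat_app 3 r V w = 0"
  obtains x where "x \<in> graded_vecs t Ds n" "w = mat_app r t W x"
proof -
  have "\<forall>a<3. (\<Sum>i<r. V a i * w i) = 0"
    using assms(2) by (auto simp: mat_app_def fun_eq_iff split: if_splits)
  then obtain x where x: "\<forall>i<r. w i = (\<Sum>j<t. W i j * x j)" using exact2 by blast
  then have "w = mat_app r t W x" using assms(1) by (auto simp: mat_app_def graded_vecs_def fun_eq_iff)
  then have "mat_app r t W (vec_component t Ds n x) = w"
    using mat_app_vec_component[OF hom_W, of n x] vec_component_id[OF assms(1)] by simp
  with that show ?thesis using vec_component_graded by metis
qed

lemma W_inj:
  assumes "x \<in> graded_vecs t Ds n" "mat_app r t W x = 0"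
  shows "x = 0"
proof
  fix j
  have "(\<Sum>j<t. W i j * x j) = 0" if "i < r" for i
    using fun_cong[OF assms(2), of i] that by (simp add: mat_app_def)
  then have "\<forall>j<t. x j = 0" by (intro exact3) simp
  then show "x j = 0 j" using assms(1) by (cases "j < t") (simp_all add: graded_vecs_def)
qed

lemma graded_dim_syzygies: "graded_dim (syzygies n) + (\<Sum>j<t. monomial_count (n - Ds j)) = (\<Sum>i<r. monomial_count (n - ds i))"
proof -
  have image_V: "syzygies n = mat_app 3 r V ` graded_vecs r ds n"
  proof (intro subset_antisym subsetI)
    fix z assume "z \<in> syzygies n"
    then show "z \<in> mat_app 3 r V ` graded_vecs r ds n" by (rule syzygies_lift) blast
  next
    fix z assume "z \<in> mat_app 3 r V ` graded_vecs r ds n"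
    then show "z \<in> syzygies n" using mat_app_graded[OF hom_V] f_mat_app_V by (auto simp only: syzygies_def)
  qed
  have K: "{w \<in> graded_vecs r ds n. mat_app 3 r V w = 0} = mat_app r t W ` graded_vecs t Ds n"
  proof (intro subset_antisym subsetI)
    fix w assume "w \<in> {w \<in> graded_vecs r ds n. mat_app 3 r V w = 0}"
    then have "w \<in> graded_vecs r ds n" "mat_app 3 r V w = 0" by auto
    then show "w \<in> mat_app r t W ` graded_vecs t Ds n" by (rule V_kernel_lift) blast
  next
    fix w assume "w \<in> mat_app r t W ` graded_vecs t Ds n"
    then show "w \<in> {w \<in> graded_vecs r ds n. mat_app 3 r V w = 0}"
      using mat_app_graded[OF hom_W] mat_app_V_W by auto
  qed
  have "graded_dim (mat_app r t W ` graded_vecs t Ds n) = graded_dim (graded_vecs t Ds n :: (nat \<Rightarrow> 'k R) set)"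
    by (rule graded_dim_image_inj[OF linear_mat_app subspace_graded_vecs order_refl W_inj])
  moreover have "graded_dim (graded_vecs r ds n :: (nat \<Rightarrow> 'k R) set) =
      graded_dim {w \<in> graded_vecs r ds n. mat_app 3 r V w = 0} + graded_dim (mat_app 3 r V ` graded_vecs r ds n)"
    by (rule graded_rank_nullity[OF linear_mat_app subspace_graded_vecs order_refl])
  ultimately show ?thesis
    unfolding K image_V[symmetric] by (simp add: graded_dim_graded_vecs)
qed

lemma graded_dim_syzygies_ge: "3 * monomial_count (n - int d) \<le> graded_dim (syzygies n) + monomial_count n"
proof -
  have g: "graded_mat 1 (\<lambda>_. 0) 3 (\<lambda>_. int d) (\<lambda>_. f)"
    using hom_f by (simp add: graded_mat_def)
  let ?G = "graded_vecs 3 (\<lambda>_. int d) n :: (nat \<Rightarrow> 'k R) set"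
  have "graded_dim ?G = graded_dim (syzygies n) + graded_dim (mat_app 1 3 (\<lambda>_. f) ` ?G)"
    unfolding syzygies_eq by (rule graded_rank_nullity[OF linear_mat_app subspace_graded_vecs order_refl])
  moreover have "graded_dim (mat_app 1 3 (\<lambda>_. f) ` ?G) \<le> graded_dim (graded_vecs 1 (\<lambda>_. 0) n :: (nat \<Rightarrow> 'k R) set)"
    using mat_app_graded[OF g] by (intro graded_dim_mono[OF _ order_refl]) auto
  ultimately show ?thesis by (simp add: graded_dim_graded_vecs)
qed

text \<open>
  Let \<open>g\<close> be the greatest common divisor of the first two forms and \<open>c\<close> its degree.  The syzygies with
  third entry zero are the multiples of a single one, in degree \<open>2 d - c\<close>.  The third entry of any
  syzygy is a multiple of \<open>g\<close>, because \<open>g\<close> divides its product with each of the forms.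
\<close>

lemma graded_dim_syzygies_le: "\<exists>c. \<forall>n. graded_dim (syzygies n) \<le> monomial_count (n - (2 * int d - c)) + monomial_count (n - (int d + c))"
proof -
  obtain g P Q where gPQ: "f 0 = g * P" "f 1 = g * Q" and cop: "\<And>x. P dvd Q * x \<Longrightarrow> P dvd x"
    using gcd_split[of "f 0" "f 1"] f_nonzero[of 0] by auto
  have nz: "g \<noteq> 0" "P \<noteq> 0" "Q \<noteq> 0" using gPQ f_nonzero[of 0] f_nonzero[of 1] by auto
  have hom01: "homogeneous (int d) (g * P)" "homogeneous (int d) (g * Q)" 
    using hom_f[of 0] hom_f[of 1] gPQ by auto
  obtain c where c: "homogeneous c g" using homogeneous_factor[OF hom01(1)] nz by auto
  have P: "homogeneous (int d - c) P"
  proof -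
    obtain c' where "homogeneous c' P"
      using homogeneous_factor[of "int d" P g] hom01 nz by (auto simp: mult.commute)
    moreover from this have "c + c' = int d"
      using homogeneous_unique[OF homogeneous_mult[OF c] hom01(1)] nz by simp
    then have "c' = int d - c" by simp
    ultimately show ?thesis by simp
  qed
  have Q: "homogeneous (int d - c) Q"
  proof -
    obtain c' where "homogeneous c' Q"
      using homogeneous_factor[of "int d" Q g] hom01 nz by (auto simp: mult.commute)
    moreover from this have "c + c' = int d"
      using homogeneous_unique[OF homogeneous_mult[OF c] hom01(2)] nz by simp
    then have "c' = int d - c" by simp
    ultimately show ?thesis by simp
  qed
  have "graded_dim (syzygies n) \<le> monomial_count (n - (2 * int d - c)) + monomial_count (n - (int d + c))" for n
  proof -
    define \<pi> where "\<pi> = mat_app 1 3 (\<lambda>_ a. if a = 2 then 1 else 0 :: 'k R)"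
    have \<pi>: "\<pi> z = (\<lambda>i. if i = 0 then z 2 else 0)" for z
      by (auto simp: \<pi>_def mat_app_def sum_3 fun_eq_iff)
    have ZG: "syzygies n \<subseteq> graded_vecs 3 (\<lambda>_. int d) n" by (auto simp: syzygies_def)
    have rn: "graded_dim (syzygies n) = graded_dim {z \<in> syzygies n. \<pi> z = 0} + graded_dim (\<pi> ` syzygies n)"
      unfolding \<pi>_def by (rule graded_rank_nullity[OF linear_mat_app subspace_syzygies ZG])
    define A where "A = (\<lambda>(a::nat) (_::nat). if a = 0 then - Q else if a = 1 then P else 0)"
    have gA: "graded_mat 3 (\<lambda>_. int d) 1 (\<lambda>_. 2 * int d - c) A"
      using P homogeneous_uminus[OF Q] by (simp add: graded_mat_def A_def)
    define B where "B = (\<lambda>(_::nat) (_::nat). g)"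
    have gB: "graded_mat 1 (\<lambda>_. int d) 1 (\<lambda>_. int d + c) B"
      using c by (simp add: graded_mat_def B_def)
    let ?S = "graded_vecs 1 (\<lambda>_. 2 * int d - c) n :: (nat \<Rightarrow> 'k R) set"
    let ?T = "graded_vecs 1 (\<lambda>_. int d + c) n :: (nat \<Rightarrow> 'k R) set"
    have "{z \<in> syzygies n. \<pi> z = 0} \<subseteq> mat_app 3 1 A ` ?S"
    proof clarify
      fix z assume z: "z \<in> syzygies n" "\<pi> z = 0"
      have z2: "z 2 = 0" using fun_cong[OF z(2), of 0] by (simp add: \<pi>)
      have "g * (P * z 0 + Q * z 1) = 0" 
        using z(1) z2 gPQ by (simp add: syzygies_def sum_3 algebra_simps)
      then have e: "P * z 0 + Q * z 1 = 0" using nz by simp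
      then have "P dvd Q * z 1" by (metis add_eq_0_iff dvd_minus_iff dvd_triv_left)
      then obtain y where y: "z 1 = P * y" using cop by (metis dvdE)
      have "P * (z 0 + Q * y) = 0" using e y by (simp add: algebra_simps)
      then have z0: "z 0 = - Q * y" using nz by (simp add: eq_neg_iff_add_eq_0)
      have "z = mat_app 3 1 A (\<lambda>_. y)"
      proof
        fix i :: nat
        consider "i = 0" | "i = 1" | "i = 2" | "i \<ge> 3" by linarith
        then show "z i = mat_app 3 1 A (\<lambda>_. y) i"
        proof cases
          case 4
          then have "z i = 0" using z(1) ZG graded_vecs_outside by (metis (no_types) not_less subsetD)
          then show ?thesis using 4 by (simp add: mat_app_def)
        qed (simp_all add: mat_app_def A_def z0 y y[unfolded One_nat_def] z2)
      qed
      then have "mat_app 3 1 A (vec_component 1 (\<lambda>_. 2 * int d - c) n (\<lambda>_. y)) = vec_component 3 (\<lambda>_. int d) n z"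
        using mat_app_vec_component[OF gA, of n "\<lambda>_. y"] by simp
      also have "\<dots> = z" using z(1) ZG by (intro vec_component_id) auto
      finally have "z = mat_app 3 1 A (vec_component 1 (\<lambda>_. 2 * int d - c) n (\<lambda>_. y))" by (rule sym)
      then show "z \<in> mat_app 3 1 A ` ?S" using vec_component_graded by blast
    qed
    moreover have "mat_app 3 1 A ` ?S \<subseteq> graded_vecs 3 (\<lambda>_. int d) n" using mat_app_graded[OF gA] by blast
    ultimately have "graded_dim {z \<in> syzygies n. \<pi> z = 0} \<le> graded_dim (mat_app 3 1 A ` ?S)" by (rule graded_dim_mono)
    also have "\<dots> \<le> graded_dim ?S" by (rule graded_dim_image_le[OF linear_mat_app subspace_graded_vecs order_refl])
    finally have 1: "graded_dim {z \<in> syzygies n. \<pi> z = 0} \<le> monomial_count (n - (2 * int d - c))"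
      by (simp add: graded_dim_graded_vecs)
    have "\<pi> ` syzygies n \<subseteq> mat_app 1 1 B ` ?T"
    proof clarify
      fix z assume z: "z \<in> syzygies n"
      have "f 0 * z 0 + f 1 * z 1 + f 2 * z 2 = 0" using z by (simp add: syzygies_def sum_3)
      then have "f 2 * z 2 = - (g * P * z 0 + g * Q * z 1)" unfolding gPQ add_eq_0_iff .
      also have "\<dots> = g * (- (P * z 0 + Q * z 1))" by (simp add: algebra_simps)
      finally have "f 2 * z 2 = g * (- (P * z 0 + Q * z 1))" .
      then have "g dvd f 2 * z 2" by (metis dvd_triv_left)
      then have "g dvd z 2"
        using gPQ by (intro grade nz(1)) (simp add: all_less_3 mult.assoc)
      then obtain y where y: "z 2 = g * y" by (elim dvdE)
      have \<pi>z: "\<pi> z = mat_app 1 1 B (\<lambda>_. y)" using y by (auto simp: \<pi> mat_app_def B_def fun_eq_iff)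
      have "mat_app 1 1 B (vec_component 1 (\<lambda>_. int d + c) n (\<lambda>_. y)) = vec_component 1 (\<lambda>_. int d) n (\<pi> z)"
        using mat_app_vec_component[OF gB, of n "\<lambda>_. y"] \<pi>z by simp
      also have "\<dots> = \<pi> z" using z by (intro vec_component_id) (auto simp: \<pi> syzygies_def graded_vecs_def)
      finally have "\<pi> z = mat_app 1 1 B (vec_component 1 (\<lambda>_. int d + c) n (\<lambda>_. y))" by (rule sym)
      then show "\<pi> z \<in> mat_app 1 1 B ` ?T" using vec_component_graded by blast
    qed
    moreover have "mat_app 1 1 B ` ?T \<subseteq> graded_vecs 1 (\<lambda>_. int d) n" using mat_app_graded[OF gB] by blast
    ultimately have "graded_dim (\<pi> ` syzygies n) \<le> graded_dim (mat_app 1 1 B ` ?T)" by (rule graded_dim_mono)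
    also have "\<dots> \<le> graded_dim ?T" by (rule graded_dim_image_le[OF linear_mat_app subspace_graded_vecs order_refl])
    finally have 2: "graded_dim (\<pi> ` syzygies n) \<le> monomial_count (n - (int d + c))"
      by (simp add: graded_dim_graded_vecs)
    show ?thesis using rn 1 2 by simp
  qed
  then show ?thesis by blast
qed

text \<open>
  Twice the dimension of the syzygies of degree \<open>n\<close> is \<open>2 n\<^sup>2 + (6 - 2 (\<Sum> d\<^sub>i - \<Sum> D\<^sub>j)) n\<close> up to a
  constant.  The lower bound and the upper bound both have \<open>6 - 6 d\<close> as linear coefficient, the upper
  one because \<open>(2 d - c) + (d + c) = 3 d\<close>.
\<close>

theorem degree_sum: "(\<Sum>i<r. ds i) = 3 * int d + (\<Sum>j<t. Ds j)"
proof -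
  obtain c where c: "\<And>n. graded_dim (syzygies n) \<le> monomial_count (n - (2 * int d - c)) + monomial_count (n - (int d + c))"
    using graded_dim_syzygies_le by blast
  \<comment> \<open>From degree \<open>N\<close> on, all Hilbert functions that occur are given by their polynomials.\<close>
  define N where "N = (\<Sum>i<r. \<bar>ds i\<bar>) + (\<Sum>j<t. \<bar>Ds j\<bar>) + 2 * int d + \<bar>c\<bar>"
  have nn: "0 \<le> (\<Sum>i<r. \<bar>ds i\<bar>)" "0 \<le> (\<Sum>j<t. \<bar>Ds j\<bar>)" by (simp_all add: sum_nonneg)
  have Nds: "ds i \<le> N" if "i < r" for i
  proof -
    have "\<bar>ds i\<bar> \<le> (\<Sum>i<r. \<bar>ds i\<bar>)" by (rule member_le_sum) (use that in auto)
    then show ?thesis unfolding N_def using nn by linarith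
  qed
  have NDs: "Ds i \<le> N" if "i < t" for i
  proof -
    have "\<bar>Ds i\<bar> \<le> (\<Sum>j<t. \<bar>Ds j\<bar>)" by (rule member_le_sum) (use that in auto)
    then show ?thesis unfolding N_def using nn by linarith
  qed
  have Nc: "2 * int d - c \<le> N" "int d + c \<le> N" "int d \<le> N" "0 \<le> N"
    unfolding N_def using nn by linarith+
  let ?X = "3 * int d + (\<Sum>j<t. Ds j) - (\<Sum>i<r. ds i)"
  let ?q = "\<lambda>n::int. n^2 + 3 * n + 2"
  let ?S = "(\<Sum>i<r. (ds i)^2) - (\<Sum>j<t. (Ds j)^2)"
  have dim_syz: "2 * int (graded_dim (syzygies n)) = 2 * ?q n + (2 * n + 3) * (?X - 3 * int d) + ?S" if "n \<ge> N" for n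
  proof -
    have "int (graded_dim (syzygies n)) = int (\<Sum>i<r. monomial_count (n - ds i)) - int (\<Sum>j<t. monomial_count (n - Ds j))"
      using graded_dim_syzygies[of n] by linarith
    then have "2 * int (graded_dim (syzygies n)) = 2 * int (\<Sum>i<r. monomial_count (n - ds i)) - 2 * int (\<Sum>j<t. monomial_count (n - Ds j))"
      by simp
    also have "\<dots> = (int r * ?q n - (2 * n + 3) * (\<Sum>i<r. ds i) + (\<Sum>i<r. (ds i)^2)) -
       (int t * ?q n - (2 * n + 3) * (\<Sum>i<t. Ds i) + (\<Sum>i<t. (Ds i)^2))"
      using Nds NDs that by (subst (1 2) sum_monomial_count) (auto, fastforce+)
    finally show ?thesis by (simp add: rank algebra_simps)
  qed
  have one: "2 * int (monomial_count (n - x)) = ?q n - (2 * n + 3) * x + x^2" if "n \<ge> N" "x \<le> N" for n x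
    using that monomial_count_eq[of "n - x"] by (simp add: power2_eq_square algebra_simps)
  have "?X = 0"
  proof (rule vanishing_of_bounded_multiples)
    fix n assume n: "N \<le> n"
    have "2 * int (graded_dim (syzygies n)) \<le> 2 * int (monomial_count (n - (2 * int d - c))) + 2 * int (monomial_count (n - (int d + c)))"
      using c[of n] by linarith
    then show "(2 * n + 3) * ?X \<le> (2 * int d - c)^2 + (int d + c)^2 - ?S"
      unfolding dim_syz[OF n] one[OF n Nc(1)] one[OF n Nc(2)] by (simp add: algebra_simps)
    have "6 * int (monomial_count (n - int d)) \<le> 2 * int (graded_dim (syzygies n)) + 2 * int (monomial_count (n - 0))"
      using graded_dim_syzygies_ge[of n] by simp
    then have "3 * (2 * int (monomial_count (n - int d))) \<le> 2 * int (graded_dim (syzygies n)) + 2 * int (monomial_count (n - 0))" by simp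
    then show "3 * (int d)^2 - ?S \<le> (2 * n + 3) * ?X"
      unfolding dim_syz[OF n] one[OF n Nc(3)] one[OF n Nc(4)] by (simp add: algebra_simps)
  qed
  then show ?thesis by simp
qed

end

section \<open>Gaps between the degrees\<close>

text \<open>
  Fewer equations than unknowns, over a domain: one equation is used to eliminate one unknown, after
  multiplying the others by its coefficient instead of dividing by it.
\<close>

lemma nontrivial_solution:
  fixes A :: "'e \<Rightarrow> 'u \<Rightarrow> 'a::idom"
  assumes "finite E" "finite U" "card E < card U"
  shows "\<exists>c. (\<exists>u\<in>U. c u \<noteq> 0) \<and> (\<forall>u. u \<notin> U \<longrightarrow> c u = 0) \<and> (\<forall>e\<in>E. (\<Sum>u\<in>U. A e u * c u) = 0)"
  using assms
proof (induction E arbitrary: U A rule: finite_induct)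
  case empty
  then obtain v where "v \<in> U" by fastforce
  then show ?case by (intro exI[of _ "\<lambda>u. if u = v then 1 else 0"]) auto
next
  case (insert e E)
  show ?case
  proof (cases "\<forall>u\<in>U. A e u = 0")
    case True
    have "card E < card U" using insert by simp
    from insert.IH[OF insert.prems(1) this, of A] obtain c where
      c: "\<exists>u\<in>U. c u \<noteq> 0" "\<forall>u. u \<notin> U \<longrightarrow> c u = 0" "\<forall>e\<in>E. (\<Sum>u\<in>U. A e u * c u) = 0" by blast
    moreover have "(\<Sum>u\<in>U. A e u * c u) = 0" using True by (intro sum.neutral) simp
    ultimately have "\<forall>e\<in>insert e E. (\<Sum>u\<in>U. A e u * c u) = 0" by blast
    with c show ?thesis by blast
  next
    case False
    then obtain v where v: "v \<in> U" "A e v \<noteq> 0" by blast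
    define U' where "U' = U - {v}"
    have U: "U = insert v U'" "v \<notin> U'" "finite U'" using v insert.prems by (auto simp: U'_def)
    then have "card E < card U'" using insert by simp
    from insert.IH[OF U(3) this, of "\<lambda>e' u. A e v * A e' u - A e' v * A e u"]
    obtain c where c: "\<exists>u\<in>U'. c u \<noteq> 0" "\<And>u. u \<notin> U' \<Longrightarrow> c u = 0"
      "\<And>e'. e' \<in> E \<Longrightarrow> (\<Sum>u\<in>U'. (A e v * A e' u - A e' v * A e u) * c u) = 0" by blast
    define c' where "c' = (\<lambda>u. if u = v then - (\<Sum>u\<in>U'. A e u * c u) else A e v * c u)"
    have eq: "(\<Sum>u\<in>U. A e' u * c' u) = (\<Sum>u\<in>U'. (A e v * A e' u - A e' v * A e u) * c u)" for e'
    proof -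
      have "(\<Sum>u\<in>U'. A e' u * c' u) = (\<Sum>u\<in>U'. A e' u * (A e v * c u))"
        using U(2) by (intro sum.cong) (auto simp: c'_def)
      then show ?thesis unfolding U(1) using U(2,3)
        by (simp add: c'_def sum_distrib_left sum_subtractf algebra_simps)
    qed
    have "(\<Sum>u\<in>U. A e' u * c' u) = 0" if "e' \<in> insert e E" for e'
      using that c(3)[of e'] unfolding eq by auto
    moreover have "\<exists>u\<in>U. c' u \<noteq> 0" using c(1) v U by (auto simp: c'_def)
    moreover have "c' u = 0" if "u \<notin> U" for u using that c(2)[of u] U by (auto simp: c'_def)
    ultimately show ?thesis by blast
  qed
qed

context three_form_resolution
begin

text \<open>
  The relations between the columns of \<open>V\<close> are combinations of columns of \<open>W\<close>.
\<close>

lemma syzygy_kernel_minimal: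
  assumes "\<forall>a<3. (\<Sum>i<r. V a i * w i) = 0" "l < r"
  shows "Poly_Mapping.lookup (w l) 0 = 0"
proof -
  obtain x where "w l = (\<Sum>j<t. W l j * x j)" using exact2[OF assms(1)] assms(2) by blast
  then show ?thesis using assms(2) min_W by (auto intro!: lookup_sum_mult_0)
qed

lemma V_column_nonzero:
  assumes "i < r"
  obtains a where "a < 3" "V a i \<noteq> 0"
proof (rule ccontr)
  assume "\<not> thesis"
  then have "\<forall>a<3. V a i = 0" using that by blast
  then have "\<forall>a<3. (\<Sum>l<r. V a l * (if l = i then 1 else 0)) = 0" by (auto intro!: sum.neutral)
  from syzygy_kernel_minimal[OF this assms] show False by simp
qed

lemma W_eq_0:
  assumes "i < r" "j < t" "Ds j \<le> ds i"
  shows "W i j = 0"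
proof (rule poly_mapping_eqI)
  fix m
  have h: "homogeneous (Ds j - ds i) (W i j)" using hom_W assms by (simp add: graded_mat_def)
  show "Poly_Mapping.lookup (W i j) m = Poly_Mapping.lookup 0 m"
  proof (cases "m = 0")
    case True
    then show ?thesis using min_W assms by simp
  next
    case False
    then have "mon_deg m \<noteq> 0" by (simp add: mon_deg_eq_0_iff)
    then have "m \<notin> Poly_Mapping.keys (W i j)" using h assms by (auto simp: homogeneous_def)
    then show ?thesis by (simp add: in_keys_iff)
  qed
qed

text \<open>
  By minimality, the columns of \<open>W\<close> in \<open>S\<close> are supported in the set \<open>T\<close> of rows counted here.  Suppose
  that \<open>T\<close> has at most \<open>card S + 1\<close> elements.  Then any two columns of \<open>V\<close> with index in \<open>T\<close> are
  proportional, hence both multiples of one syzygy \<open>s\<close> by unique factorization.  But \<open>s\<close> is itself a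
  combination of columns of \<open>V\<close>, so two minimal generators would be multiples of one element of the
  module they generate, which minimality forbids.
\<close>

theorem degree_gap:
  assumes S: "S \<subseteq> {..<t}" "S \<noteq> {}"
  shows "card S + 2 \<le> card {i. i < r \<and> (\<exists>j\<in>S. ds i < Ds j)}"
proof (rule ccontr)
  define T where "T = {i. i < r \<and> (\<exists>j\<in>S. ds i < Ds j)}"
  assume "\<not> card S + 2 \<le> card {i. i < r \<and> (\<exists>j\<in>S. ds i < Ds j)}"
  then have cT: "card T \<le> card S + 1" by (simp add: T_def)
  have T: "finite T" "\<And>i. i \<in> T \<Longrightarrow> i < r" and fS: "finite S"
    using S finite_subset by (auto simp: T_def)
  have supp: "W i j = 0" if "i < r" "i \<notin> T" "j \<in> S" for i j
    using that S by (intro W_eq_0) (auto simp: T_def)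
  have minor: "V a i * V b i' = V a i' * V b i" if ii: "i \<in> T" "i' \<in> T" "i \<noteq> i'" and ab: "a < 3" "b < 3" for i i' a b
  proof (rule ccontr)
    assume ne: "V a i * V b i' \<noteq> V a i' * V b i"
    have "card {i, i'} \<le> card T" using ii T by (intro card_mono) auto
    \<comment> \<open>Few enough equations for a nonzero combination of the columns in \<open>S\<close> that vanishes outside the rows \<open>i\<close> and \<open>i'\<close>.\<close>
    then have "card (T - {i, i'}) < card S" using ii cT T by (simp add: card_Diff_subset)
    from nontrivial_solution[OF _ fS this, of W] T obtain c where
      c: "\<exists>j\<in>S. c j \<noteq> 0" "\<And>j. j \<notin> S \<Longrightarrow> c j = 0" "\<And>l. l \<in> T - {i, i'} \<Longrightarrow> (\<Sum>j\<in>S. W l j * c j) = 0"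
      by auto
    define w where "w = (\<lambda>l. \<Sum>j<t. W l j * c j)"
    have w: "w l = (\<Sum>j\<in>S. W l j * c j)" for l
      unfolding w_def using S c(2) by (intro sum.mono_neutral_right) auto
    have w0: "w l = 0" if "l < r" "l \<noteq> i" "l \<noteq> i'" for l
      using that c(3)[of l] supp[of l] by (cases "l \<in> T") (auto simp: w intro!: sum.neutral)
    have Vw: "V e i * w i + V e i' * w i' = 0" if "e < 3" for e
    proof -
      have "(\<Sum>l<r. V e l * w l) = (\<Sum>j<t. (\<Sum>l<r. V e l * W l j) * c j)"
        unfolding w_def sum_distrib_left sum_distrib_right by (subst sum.swap) (simp add: mult.assoc)
      also have "\<dots> = 0" using VW that by simp
      finally have "(\<Sum>l<r. V e l * w l) = 0" .
      moreover have "(\<Sum>l<r. V e l * w l) = (\<Sum>l\<in>{i, i'}. V e l * w l)"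
        using w0 T ii by (intro sum.mono_neutral_right) auto
      ultimately show ?thesis using ii by simp
    qed
    have "(V a i * V b i' - V a i' * V b i) * w i = V b i' * (V a i * w i + V a i' * w i') - V a i' * (V b i * w i + V b i' * w i')"
      by (simp add: algebra_simps)
    then have wi: "w i = 0" using Vw ab ne by simp
    have "(V a i * V b i' - V a i' * V b i) * w i' = V a i * (V b i * w i + V b i' * w i') - V b i * (V a i * w i + V a i' * w i')"
      by (simp add: algebra_simps)
    then have wi': "w i' = 0" using Vw ab ne by simp
    have "\<forall>l<r. w l = 0" using w0 wi wi' by metis
    then have "\<forall>j<t. c j = 0" unfolding w_def by (rule exact3)
    then show False using c(1) S by auto
  qed
  obtain i i' where ii: "i \<in> T" "i' \<in> T" "i \<noteq> i'"
  proof (rule ccontr)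
    assume "\<not> thesis"
    then have uniq: "\<And>i i'. i \<in> T \<Longrightarrow> i' \<in> T \<Longrightarrow> i = i'" using that by blast
    obtain j where j: "j \<in> S" "j < t" using S by auto
    have "\<exists>i<r. W i j \<noteq> 0"
    proof (rule ccontr)
      assume "\<not> (\<exists>i<r. W i j \<noteq> 0)"
      then have "\<forall>i<r. (\<Sum>l<t. W i l * (if l = j then 1 else 0)) = 0" by (auto intro!: sum.neutral)
      from exact3[OF this] j show False by auto
    qed
    then obtain i where i: "i < r" "W i j \<noteq> 0" by blast
    then have iT: "i \<in> T" using supp j by blast
    \<comment> \<open>If \<open>T\<close> had one element \<open>i\<close> only, a column of \<open>W\<close> supported there would force column \<open>i\<close> of \<open>V\<close> to be zero.\<close>
    have W0: "W l j = 0" if "l < r" "l \<noteq> i" for l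
      using supp[OF that(1) _ j(1)] uniq[OF iT, of l] that(2) by blast
    have "V b i = 0" if "b < 3" for b
    proof -
      have "(\<Sum>l<r. V b l * W l j) = (\<Sum>l\<in>{i}. V b l * W l j)"
        using W0 i by (intro sum.mono_neutral_right) auto
      then show ?thesis using VW[OF that j(2)] i by simp
    qed
    then show False using V_column_nonzero[OF i(1)] by blast
  qed
  then have ir: "i < r" "i' < r" using T by auto
  obtain a where a: "a < 3" "V a i \<noteq> 0" using V_column_nonzero ir by blast
  obtain g P Q where gPQ: "V a i = g * P" "V a i' = g * Q" and cop: "\<And>x. P dvd Q * x \<Longrightarrow> P dvd x"
    using gcd_split[OF a(2)] by metis
  have nz: "g \<noteq> 0" "P \<noteq> 0" using gPQ a by auto
  have PQ: "P * V b i' = Q * V b i" if "b < 3" for b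
  proof -
    have "g * (P * V b i') = g * (Q * V b i)" using minor[OF ii a(1) that] gPQ by (simp add: mult.assoc)
    then show ?thesis using nz by simp
  qed
  have "\<forall>b. \<exists>y. b < 3 \<longrightarrow> V b i = P * y"
    using PQ cop by (metis dvdE dvd_triv_left)
  then obtain s where s: "\<And>b. b < 3 \<Longrightarrow> V b i = P * s b" by metis
  have s': "V b i' = Q * s b" if "b < 3" for b
  proof -
    have "P * V b i' = P * (Q * s b)" using PQ[OF that] s[OF that] by (simp add: algebra_simps)
    then show ?thesis using nz by simp
  qed
  have "P * (\<Sum>b<3. f b * s b) = (\<Sum>b<3. f b * V b i)"
    unfolding sum_distrib_left by (rule sum.cong) (auto simp: s algebra_simps)
  then have "(\<Sum>b<3. f b * s b) = 0" using fV[OF ir(1)] nz by simp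
  then obtain w where w: "\<forall>b<3. s b = (\<Sum>l<r. V b l * w l)" using exact1 by blast
  \<comment> \<open>Whenever column \<open>k\<close> of \<open>V\<close> is \<open>q s\<close>, the vector \<open>q w - e\<^sub>k\<close> is a relation between the columns.\<close>
  have gen: "Poly_Mapping.lookup (q * w l - (if l = k then 1 else 0)) 0 = 0"
    if "\<And>b. b < 3 \<Longrightarrow> V b k = q * s b" "k < r" "l < r" for q k l
  proof (rule syzygy_kernel_minimal[of "\<lambda>l. q * w l - (if l = k then 1 else 0)", OF _ that(3)], intro allI impI)
    fix b :: nat assume b: "b < 3"
    have "(\<Sum>l<r. V b l * (q * w l - (if l = k then 1 else 0))) = q * (\<Sum>l<r. V b l * w l) - (\<Sum>l<r. if l = k then V b l else 0)"
      unfolding sum_distrib_left sum_subtractf[symmetric] by (rule sum.cong) (auto simp: algebra_simps)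
    also have "\<dots> = q * s b - V b k" using w b that(2) by simp
    finally show "(\<Sum>l<r. V b l * (q * w l - (if l = k then 1 else 0))) = 0" using that(1)[OF b] by simp
  qed
  \<comment> \<open>So \<open>w\<^sub>i\<close> has nonzero constant coefficient, and so has \<open>Q\<close>; yet their product has none.\<close>
  let ?e = "\<lambda>p. Poly_Mapping.lookup p 0"
  have "?e P * ?e (w i) = 1" using gen[of i P i, OF s ir(1) ir(1)] by (simp add: lookup_minus lookup_mult_0)
  moreover have "?e Q * ?e (w i) = 0" using gen[of i' Q i, OF s' ir(2) ir(1)] ii by (simp add: lookup_minus lookup_mult_0)
  moreover have "?e Q * ?e (w i') = 1" using gen[of i' Q i', OF s' ir(2) ir(2)] by (simp add: lookup_minus lookup_mult_0)
  ultimately show False by auto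
qed

end

section \<open>Comparison with the Koszul complex\<close>

context three_form_resolution
begin

text \<open>
  The matrix of the cross product \<open>y \<mapsto> y \<times> f\<close>, whose columns are the Koszul syzygies.
\<close>

definition koszul :: "nat \<Rightarrow> nat \<Rightarrow> 'k R" where
  "koszul a l = (if a = 0 \<and> l = 1 then f 2 else if a = 0 \<and> l = 2 then - f 1
    else if a = 1 \<and> l = 0 then - f 2 else if a = 1 \<and> l = 2 then f 0
    else if a = 2 \<and> l = 0 then f 1 else if a = 2 \<and> l = 1 then - f 0 else 0)"

lemma koszul_mult: "(\<Sum>l<3. koszul 0 l * y l) = f 2 * y 1 - f 1 * y 2"
  "(\<Sum>l<3. koszul 1 l * y l) = f 0 * y 2 - f 2 * y 0"
  "(\<Sum>l<3. koszul 2 l * y l) = f 1 * y 0 - f 0 * y 1"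
  by (simp_all add: sum_3 koszul_def)

lemma koszul_syzygy: "(\<Sum>a<3. f a * koszul a l) = 0"
  by (auto simp: sum_3 koszul_def)

lemma homogeneous_koszul: "homogeneous (int d) (koszul a l)"
  using hom_f[of 0] hom_f[of 1] hom_f[of 2] homogeneous_uminus by (auto simp: koszul_def)

lemma koszul_lift_ex:
  obtains \<alpha> g where "graded_mat r ds 3 (\<lambda>_. 2 * int d) \<alpha>"
    "\<And>a l. a < 3 \<Longrightarrow> l < 3 \<Longrightarrow> (\<Sum>i<r. V a i * \<alpha> i l) = koszul a l"
    "g \<in> graded_vecs t Ds (3 * int d)"
    "\<And>i. i < r \<Longrightarrow> (\<Sum>l<3. \<alpha> i l * f l) = (\<Sum>j<t. W i j * g j)"
proof -
  have "\<exists>w. w \<in> graded_vecs r ds (2 * int d) \<and> (\<forall>a<3. koszul a l = (\<Sum>i<r. V a i * w i))" for l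
  proof -
    have "(\<lambda>a. if a < 3 then koszul a l else 0) \<in> syzygies (2 * int d)"
      using koszul_syzygy[of l] homogeneous_koszul by (auto simp: syzygies_def graded_vecs_def)
    then obtain w where w: "w \<in> graded_vecs r ds (2 * int d)" "(\<lambda>a. if a < 3 then koszul a l else 0) = mat_app 3 r V w"
      by (rule syzygies_lift)
    have "koszul a l = (\<Sum>i<r. V a i * w i)" if "a < 3" for a
      using fun_cong[OF w(2), of a] that by (simp add: mat_app_def)
    with w show ?thesis by blast
  qed
  then obtain \<beta> where \<beta>: "\<And>l. \<beta> l \<in> graded_vecs r ds (2 * int d)"
    "\<And>l a. a < 3 \<Longrightarrow> koszul a l = (\<Sum>i<r. V a i * \<beta> l i)" by metis
  define \<alpha> where "\<alpha> = (\<lambda>i l. \<beta> l i)"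
  have g\<alpha>: "graded_mat r ds 3 (\<lambda>_. 2 * int d) \<alpha>"
    using \<beta>(1) by (auto simp: graded_mat_def \<alpha>_def graded_vecs_def)
  define F where "F = (\<lambda>l. if l < 3 then f l else 0)"
  have F: "F \<in> graded_vecs 3 (\<lambda>_. 2 * int d) (3 * int d)"
    using hom_f by (auto simp: F_def graded_vecs_def)
  have "mat_app 3 r V (mat_app r 3 \<alpha> F) = 0"
  proof
    fix a
    show "mat_app 3 r V (mat_app r 3 \<alpha> F) a = 0 a"
    proof (cases "a < 3")
      case True
      then have "mat_app 3 r V (mat_app r 3 \<alpha> F) a = (\<Sum>l<3. (\<Sum>i<r. V a i * \<alpha> i l) * F l)"
        unfolding mat_app_def sum_distrib_right by (subst sum.swap) (simp add: sum_distrib_left mult.assoc)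
      also have "\<dots> = (\<Sum>l<3. koszul a l * F l)" using \<beta>(2) True by (simp add: \<alpha>_def)
      also have "\<dots> = 0"
      proof -
        have "(\<Sum>l<3. koszul 0 l * f l) = 0" "(\<Sum>l<3. koszul 1 l * f l) = 0" "(\<Sum>l<3. koszul 2 l * f l) = 0"
          unfolding koszul_mult by (simp_all add: mult.commute)
        moreover have "(\<Sum>l<3. koszul a l * F l) = (\<Sum>l<3. koszul a l * f l)"
          by (rule sum.cong) (auto simp: F_def)
        moreover have "a = 0 \<or> a = 1 \<or> a = 2" using True by linarith
        ultimately show ?thesis by metis
      qed
      finally show ?thesis by simp
    qed (simp add: mat_app_def)
  qed
  then obtain g where g: "g \<in> graded_vecs t Ds (3 * int d)" "mat_app r 3 \<alpha> F = mat_app r t W g"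
    using V_kernel_lift[OF mat_app_graded[OF g\<alpha> F]] by blast
  have "(\<Sum>l<3. \<alpha> i l * f l) = (\<Sum>j<t. W i j * g j)" if "i < r" for i
    using fun_cong[OF g(2), of i] that by (simp add: mat_app_def F_def)
  with g\<alpha> g(1) show ?thesis using \<beta>(2) by (intro that[of \<alpha> g]) (auto simp: \<alpha>_def)
qed

end

text \<open>
  The matrix \<open>\<alpha>\<close> and the vector \<open>g\<close> are the components in homological degrees two and three of a
  comparison map from the Koszul complex of \<open>f\<close> to the resolution that is the identity below.
\<close>

locale koszul_comparison = three_form_resolution +
  fixes \<alpha> :: "nat \<Rightarrow> nat \<Rightarrow> 'a R" and g :: "nat \<Rightarrow> 'a R"
  assumes hom_\<alpha>: "graded_mat r ds 3 (\<lambda>_. 2 * int d) \<alpha>"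
    and V_\<alpha>: "a < 3 \<Longrightarrow> l < 3 \<Longrightarrow> (\<Sum>i<r. V a i * \<alpha> i l) = koszul a l"
    and hom_g: "g \<in> graded_vecs t Ds (3 * int d)"
    and \<alpha>_f: "i < r \<Longrightarrow> (\<Sum>l<3. \<alpha> i l * f l) = (\<Sum>j<t. W i j * g j)"
begin

lemma V_\<alpha>_mult: "a < 3 \<Longrightarrow> (\<Sum>i<r. V a i * (\<Sum>b<3. \<alpha> i b * y b)) = (\<Sum>b<3. koszul a b * y b)"
proof -
  assume a: "a < 3"
  have "(\<Sum>i<r. V a i * (\<Sum>b<3. \<alpha> i b * y b)) = (\<Sum>b<3. (\<Sum>i<r. V a i * \<alpha> i b) * y b)"
    unfolding sum_distrib_left sum_distrib_right by (subst sum.swap) (simp add: mult.assoc)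
  then show ?thesis using V_\<alpha> a by simp
qed

lemma V_W_mult: "a < 3 \<Longrightarrow> (\<Sum>i<r. V a i * (\<Sum>j<t. W i j * x j)) = 0"
proof -
  assume a: "a < 3"
  have "(\<Sum>i<r. V a i * (\<Sum>j<t. W i j * x j)) = (\<Sum>j<t. (\<Sum>i<r. V a i * W i j) * x j)"
    unfolding sum_distrib_left sum_distrib_right by (subst sum.swap) (simp add: mult.assoc)
  then show ?thesis using VW a by simp
qed

text \<open>
  The forms annihilate the first Koszul homology: every syzygy \<open>z\<close> satisfies
  \<open>f\<^sub>k z = (e\<^sub>k \<times> z) \<times> f\<close>, as \<open>(e\<^sub>k \<times> z) \<times> f = z (e\<^sub>k \<cdot> f) - e\<^sub>k (z \<cdot> f)\<close>.  Apply this to a column of \<open>V\<close>.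
\<close>

lemma f_multiple_in_image:
  assumes "i < r" "k < 3"
  shows "\<exists>x y. \<forall>l<r. (if l = i then f k else 0) = (\<Sum>j<t. W l j * x j) + (\<Sum>b<3. \<alpha> l b * y b)"
proof -
  define z where "z = (\<lambda>b. V b i)"
  define y where "y = (\<lambda>b::nat. if k = 0 then (if b = 1 then - z 2 else if b = 2 then z 1 else 0)
    else if k = 1 then (if b = 0 then z 2 else if b = 2 then - z 0 else 0)
    else (if b = 0 then - z 1 else if b = 1 then z 0 else 0))"
  have zf: "f 0 * z 0 + f 1 * z 1 + f 2 * z 2 = 0" using fV[OF assms(1)] by (simp add: sum_3 z_def)
  have ky: "(\<Sum>b<3. koszul a b * y b) = f k * z a" if "a < 3" for a
  proof -
    have "f 0 * z 0 = (f 0 * z 0 + f 1 * z 1 + f 2 * z 2) - f 1 * z 1 - f 2 * z 2"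
      "f 1 * z 1 = (f 0 * z 0 + f 1 * z 1 + f 2 * z 2) - f 0 * z 0 - f 2 * z 2"
      "f 2 * z 2 = (f 0 * z 0 + f 1 * z 1 + f 2 * z 2) - f 0 * z 0 - f 1 * z 1" by simp_all
    then have e: "f 0 * z 0 = - (f 1 * z 1) - f 2 * z 2" "f 1 * z 1 = - (f 0 * z 0) - f 2 * z 2"
      "f 2 * z 2 = - (f 0 * z 0) - f 1 * z 1" unfolding zf by simp_all
    have "k = 0 \<or> k = 1 \<or> k = 2" "a = 0 \<or> a = 1 \<or> a = 2" using assms(2) that by linarith+
    then consider "k = 0 \<and> a = 0" | "k = 1 \<and> a = 1" | "k = 2 \<and> a = 2" 
      | "k \<noteq> a" "(k = 0 \<or> k = 1 \<or> k = 2) \<and> (a = 0 \<or> a = 1 \<or> a = 2)" by blast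
    then show ?thesis
    proof cases
      case 1
      then have "(\<Sum>b<3. koszul a b * y b) = - (f 1 * z 1) - f 2 * z 2"
        by (simp add: koszul_mult y_def)
      then show ?thesis using 1 e(1) by simp
    next
      case 2
      then have "(\<Sum>b<3. koszul a b * y b) = - (f 0 * z 0) - f 2 * z 2"
        unfolding conjunct2[OF 2] koszul_mult by (simp add: y_def)
      then show ?thesis using 2 e(2) by simp
    next
      case 3
      then have "(\<Sum>b<3. koszul a b * y b) = - (f 0 * z 0) - f 1 * z 1"
        by (simp add: koszul_mult y_def)
      then show ?thesis using 3 e(3) by simp
    next
      case 4
      then show ?thesis
        by (auto simp: koszul_mult koszul_mult(2)[unfolded One_nat_def] y_def algebra_simps)
    qed
  qed
  define u where "u = (\<lambda>l. (if l = i then f k else 0) - (\<Sum>b<3. \<alpha> l b * y b))"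
  have "(\<Sum>l<r. V a l * u l) = 0" if "a < 3" for a
  proof -
    have "(\<Sum>l<r. V a l * u l) = (\<Sum>l<r. if l = i then V a l * f k else 0) - (\<Sum>l<r. V a l * (\<Sum>b<3. \<alpha> l b * y b))"
      unfolding sum_subtractf[symmetric] by (rule sum.cong) (auto simp: u_def algebra_simps)
    also have "\<dots> = V a i * f k - f k * z a"
      unfolding V_\<alpha>_mult[OF that] ky[OF that] using assms by simp
    finally show ?thesis by (simp add: z_def)
  qed
  then obtain x where "\<forall>l<r. u l = (\<Sum>j<t. W l j * x j)" using exact2 by blast
  then have "\<forall>l<r. (if l = i then f k else 0) = (\<Sum>j<t. W l j * x j) + (\<Sum>b<3. \<alpha> l b * y b)"
    by (auto simp: u_def algebra_simps)
  then show ?thesis by blast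
qed

text \<open>
  The second Koszul homology vanishes: if \<open>y \<times> f = 0\<close> then \<open>f\<^sub>0\<close> divides \<open>f\<^sub>b y\<^sub>0\<close> for all \<open>b\<close>, hence \<open>y\<^sub>0\<close>,
  and so \<open>y\<close> is a multiple of \<open>f\<close>.
\<close>

lemma image_relations:
  assumes "\<And>l. l < r \<Longrightarrow> (\<Sum>j<t. W l j * x j) + (\<Sum>b<3. \<alpha> l b * y b) = 0"
  obtains \<tau> where "\<And>b. b < 3 \<Longrightarrow> y b = \<tau> * f b" "\<And>j. j < t \<Longrightarrow> x j = - \<tau> * g j"
proof -
  have k: "(\<Sum>b<3. koszul a b * y b) = 0" if "a < 3" for a
  proof -
    have "(\<Sum>l<r. V a l * ((\<Sum>j<t. W l j * x j) + (\<Sum>b<3. \<alpha> l b * y b))) = 0"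
      using assms by simp
    then show ?thesis using V_W_mult[OF that] V_\<alpha>_mult[OF that]
      by (simp add: distrib_left sum.distrib)
  qed
  have e: "f b * y 0 = f 0 * y b" if "b < 3" for b
  proof -
    have "b = 0 \<or> b = 1 \<or> b = 2" using that by linarith
    then show ?thesis using k[of 1] k[of 2] by (auto simp: koszul_mult koszul_mult(2)[unfolded One_nat_def])
  qed
  then have "f 0 dvd y 0" by (intro grade f_nonzero) auto
  then obtain \<tau> where \<tau>: "y 0 = f 0 * \<tau>" by (elim dvdE)
  have y: "y b = \<tau> * f b" if "b < 3" for b
  proof -
    have "f 0 * y b = f b * y 0" using e[OF that] by (rule sym)
    also have "\<dots> = f 0 * (\<tau> * f b)" unfolding \<tau> by (simp only: mult_ac)
    finally have "f 0 * y b = f 0 * (\<tau> * f b)" .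
    moreover have "f 0 \<noteq> 0" using f_nonzero by simp
    ultimately show ?thesis using mult_left_cancel by blast
  qed
  have "(\<Sum>j<t. W l j * (x j + \<tau> * g j)) = 0" if "l < r" for l
  proof -
    have "(\<Sum>b<3. \<alpha> l b * y b) = \<tau> * (\<Sum>b<3. \<alpha> l b * f b)"
      unfolding sum_distrib_left by (rule sum.cong) (auto simp: y algebra_simps)
    also have "\<dots> = \<tau> * (\<Sum>j<t. W l j * g j)" using \<alpha>_f that by simp
    finally have "(\<Sum>b<3. \<alpha> l b * y b) = (\<Sum>j<t. W l j * (\<tau> * g j))"
      by (simp add: sum_distrib_left algebra_simps)
    then show ?thesis using assms[OF that] by (simp add: distrib_left sum.distrib)
  qed
  then have "\<forall>j<t. x j + \<tau> * g j = 0" by (intro exact3) auto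
  then have "x j = - \<tau> * g j" if "j < t" for j using that by (simp add: eq_neg_iff_add_eq_0)
  with y show ?thesis by (rule that)
qed

text \<open>
  Suppose \<open>g\<^sub>j = c \<cdot> f\<close>, where \<open>j\<close> is \<open>j0\<close>.  Then \<open>H (W x + \<alpha> y) = x\<^sub>j + c \<cdot> y\<close> is a well-defined linear form
  on the image of \<open>(W, \<alpha>)\<close>, because the relations of \<open>(W, \<alpha>)\<close> are the multiples of \<open>(- g, f)\<close>.  The image
  contains all multiples of unit vectors by the forms, and \<open>f\<^sub>k H (f\<^sub>0 e\<^sub>i) = f\<^sub>0 H (f\<^sub>k e\<^sub>i)\<close> makes
  \<open>H (f\<^sub>0 e\<^sub>i)\<close> divisible by \<open>f\<^sub>0\<close>.  The quotients \<open>u\<^sub>i\<close> extend \<open>H\<close> to a row with \<open>(u W)\<^sub>j = 1\<close>, against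
  minimality.  In other words, the first Koszul homology has no first extension group with values in
  \<open>R\<close>, since it is annihilated by an ideal of grade two.
\<close>

theorem g_notin_ideal:
  assumes "j0 < t"
  shows "g j0 \<noteq> (\<Sum>b<3. c b * f b)"
proof
  assume gc: "g j0 = (\<Sum>b<3. c b * f b)"
  define H where "H = (\<lambda>x y. x j0 + (\<Sum>b<3. c b * y b))"
  have H0: "H x y = 0" if xy: "\<And>l. l < r \<Longrightarrow> (\<Sum>j<t. W l j * x j) + (\<Sum>b<3. \<alpha> l b * y b) = 0" for x y
  proof -
    obtain \<tau> where y: "\<And>b. b < 3 \<Longrightarrow> y b = \<tau> * f b" and x: "\<And>j. j < t \<Longrightarrow> x j = - \<tau> * g j"
      using image_relations[OF xy] by metis
    have "(\<Sum>b<3. c b * y b) = \<tau> * (\<Sum>b<3. c b * f b)"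
      unfolding sum_distrib_left by (rule sum.cong) (auto simp: y algebra_simps)
    then show ?thesis using x[OF assms] by (simp add: H_def gc)
  qed
  define R where "R = (\<lambda>i k x y. \<forall>l<r. (if l = i then f k else 0) =
    (\<Sum>j<t. W l j * x j) + (\<Sum>b<3. \<alpha> l b * y b))"
  have "\<forall>i k. \<exists>x y. i < r \<and> k < 3 \<longrightarrow> R i k x y"
    unfolding R_def using f_multiple_in_image by blast
  then obtain X where "\<forall>i k. \<exists>y. i < r \<and> k < 3 \<longrightarrow> R i k (X i k) y" by metis
  then obtain Y where R: "\<And>i k. i < r \<Longrightarrow> k < 3 \<Longrightarrow> R i k (X i k) (Y i k)" by metis
  have XY: "(if l = i then f k else 0) = (\<Sum>j<t. W l j * X i k j) + (\<Sum>b<3. \<alpha> l b * Y i k b)"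
    if "i < r" "k < 3" "l < r" for i k l
    using R[OF that(1,2)] that(3) unfolding R_def by blast
  have comm: "f k * H (X i 0) (Y i 0) = f 0 * H (X i k) (Y i k)" if "i < r" "k < 3" for i k
  proof -
    have "H (\<lambda>j. f k * X i 0 j - f 0 * X i k j) (\<lambda>b. f k * Y i 0 b - f 0 * Y i k b) = 0"
    proof (rule H0)
      fix l assume l: "l < r"
      have "(\<Sum>j<t. W l j * (f k * X i 0 j - f 0 * X i k j)) + (\<Sum>b<3. \<alpha> l b * (f k * Y i 0 b - f 0 * Y i k b)) =
        f k * ((\<Sum>j<t. W l j * X i 0 j) + (\<Sum>b<3. \<alpha> l b * Y i 0 b)) - f 0 * ((\<Sum>j<t. W l j * X i k j) + (\<Sum>b<3. \<alpha> l b * Y i k b))"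
        by (simp add: right_diff_distrib sum_subtractf sum_distrib_left algebra_simps)
      also have "\<dots> = f k * (if l = i then f 0 else 0) - f 0 * (if l = i then f k else 0)"
        using XY[of i 0 l] XY[of i k l] that l by simp
      also have "\<dots> = 0" by simp
      finally show "(\<Sum>j<t. W l j * (f k * X i 0 j - f 0 * X i k j)) + (\<Sum>b<3. \<alpha> l b * (f k * Y i 0 b - f 0 * Y i k b)) = 0" .
    qed
    then show ?thesis by (simp add: H_def right_diff_distrib sum_subtractf sum_distrib_left algebra_simps)
  qed
  have "f 0 dvd H (X i 0) (Y i 0)" if "i < r" for i
    using comm[OF that] by (intro grade f_nonzero) auto
  then have "\<forall>i. \<exists>u. i < r \<longrightarrow> H (X i 0) (Y i 0) = f 0 * u" by (metis dvdE)
  then obtain u where u: "\<And>i. i < r \<Longrightarrow> H (X i 0) (Y i 0) = f 0 * u i" by metis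
  have "H (\<lambda>j. (\<Sum>i<r. W i j0 * X i 0 j) - (if j = j0 then f 0 else 0)) (\<lambda>b. \<Sum>i<r. W i j0 * Y i 0 b) = 0"
  proof (rule H0)
    fix l assume l: "l < r"
    have "(\<Sum>j<t. W l j * (\<Sum>i<r. W i j0 * X i 0 j)) = (\<Sum>i<r. W i j0 * (\<Sum>j<t. W l j * X i 0 j))"
      unfolding sum_distrib_left by (subst sum.swap) (simp add: algebra_simps)
    moreover have "(\<Sum>b<3. \<alpha> l b * (\<Sum>i<r. W i j0 * Y i 0 b)) = (\<Sum>i<r. W i j0 * (\<Sum>b<3. \<alpha> l b * Y i 0 b))"
      unfolding sum_distrib_left by (subst sum.swap) (simp add: algebra_simps)
    moreover have "(\<Sum>i<r. W i j0 * (\<Sum>j<t. W l j * X i 0 j)) + (\<Sum>i<r. W i j0 * (\<Sum>b<3. \<alpha> l b * Y i 0 b)) =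
      (\<Sum>i<r. W i j0 * (if l = i then f 0 else 0))"
      unfolding sum.distrib[symmetric] distrib_left[symmetric]
      by (rule sum.cong) (use XY[of _ 0 l] l in auto)
    moreover have "(\<Sum>i<r. W i j0 * (if l = i then f 0 else 0)) = W l j0 * f 0"
      using l by (simp add: if_distrib cong: if_cong)
    moreover have "(\<Sum>j<t. W l j * (if j = j0 then f 0 else 0)) = W l j0 * f 0"
      using assms by (simp add: if_distrib cong: if_cong)
    ultimately show "(\<Sum>j<t. W l j * ((\<Sum>i<r. W i j0 * X i 0 j) - (if j = j0 then f 0 else 0))) + (\<Sum>b<3. \<alpha> l b * (\<Sum>i<r. W i j0 * Y i 0 b)) = 0"
      by (simp add: right_diff_distrib sum_subtractf diff_add_eq)
  qed
  moreover have "H (\<lambda>j. (\<Sum>i<r. W i j0 * X i 0 j) - (if j = j0 then f 0 else 0)) (\<lambda>b. \<Sum>i<r. W i j0 * Y i 0 b)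
     = (\<Sum>i<r. W i j0 * H (X i 0) (Y i 0)) - f 0"
  proof -
    have "(\<Sum>b<3. c b * (\<Sum>i<r. W i j0 * Y i 0 b)) = (\<Sum>i<r. W i j0 * (\<Sum>b<3. c b * Y i 0 b))"
      unfolding sum_distrib_left by (subst sum.swap) (simp add: algebra_simps)
    then show ?thesis by (simp add: H_def distrib_left sum.distrib)
  qed
  moreover have "(\<Sum>i<r. W i j0 * H (X i 0) (Y i 0)) = f 0 * (\<Sum>i<r. W i j0 * u i)"
    unfolding sum_distrib_left by (rule sum.cong) (auto simp: u algebra_simps)
  ultimately have "f 0 * (\<Sum>i<r. W i j0 * u i) = f 0 * 1" by simp
  then have "(\<Sum>i<r. W i j0 * u i) = 1" using f_nonzero[of 0] by simp
  then show False using lookup_sum_mult_0[of "{..<r}" "\<lambda>i. W i j0" u] min_W assms by auto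
qed

end

section \<open>The saturation\<close>

text \<open>
  The symmetry of \<open>(x + 1) (x + 2)\<close> under \<open>x \<mapsto> - 3 - x\<close>, summed over the degrees of the resolution.
\<close>

lemma euler_characteristic_symmetry:
  fixes r t n d s S :: int
  assumes "s = 3 * d + S" "r = t + 2"
  shows "r * (n^2 + 3 * n + 2) + (2 * n + 3) * s + A =
    (r * ((n + 3 * d)^2 + 3 * (n + 3 * d) + 2) - (2 * (n + 3 * d) + 3) * s + A -
     (t * ((n + 3 * d)^2 + 3 * (n + 3 * d) + 2) - (2 * (n + 3 * d) + 3) * S + B)) +
    (t * (n^2 + 3 * n + 2) + (2 * n + 3) * S + B)"
  unfolding assms by (simp add: power2_eq_square algebra_simps)

lemma mat_app_pairing:
  "(\<Sum>j<t. mat_app t r (\<lambda>j i. M i j) u j * x j) = (\<Sum>i<r. u i * (\<Sum>j<t. M i j * x j))"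
proof -
  have "(\<Sum>j<t. mat_app t r (\<lambda>j i. M i j) u j * x j) = (\<Sum>j<t. (\<Sum>i<r. M i j * u i) * x j)"
    by (simp add: mat_app_def)
  also have "\<dots> = (\<Sum>i<r. u i * (\<Sum>j<t. M i j * x j))"
    unfolding sum_distrib_left sum_distrib_right by (subst sum.swap) (simp add: mult_ac)
  finally show ?thesis .
qed

context koszul_comparison
begin

lemma row_pairing:
  assumes "u \<in> graded_vecs r (\<lambda>i. - ds i) n"
  shows "(\<Sum>j<t. mat_app t r (\<lambda>j i. W i j) u j * g j) = (\<Sum>a<3. mat_app 3 r (\<lambda>a i. \<alpha> i a) u a * f a)"
proof -
  have "(\<Sum>j<t. mat_app t r (\<lambda>j i. W i j) u j * g j) = (\<Sum>i<r. u i * (\<Sum>j<t. W i j * g j))"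
    by (rule mat_app_pairing)
  also have "\<dots> = (\<Sum>i<r. u i * (\<Sum>a<3. \<alpha> i a * f a))" using \<alpha>_f by simp
  also have "\<dots> = (\<Sum>a<3. mat_app 3 r (\<lambda>a i. \<alpha> i a) u a * f a)"
    by (rule mat_app_pairing[symmetric])
  finally show ?thesis .
qed

text \<open>
  A row killing \<open>W\<close> and \<open>\<alpha>\<close> kills all multiples of unit vectors by \<open>f\<^sub>0\<close>.
\<close>

lemma row_kernel_trivial:
  assumes u: "u \<in> graded_vecs r (\<lambda>i. - ds i) n"
    and "mat_app t r (\<lambda>j i. W i j) u = 0" "mat_app 3 r (\<lambda>a i. \<alpha> i a) u = 0"
  shows "u = 0"
proof
  fix i
  show "u i = 0 i"
  proof (cases "i < r")
    case True
    obtain x y where xy: "\<forall>l<r. (if l = i then f 0 else 0) = (\<Sum>j<t. W l j * x j) + (\<Sum>b<3. \<alpha> l b * y b)"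
      using f_multiple_in_image[OF True, of 0] by auto
    have "u i * f 0 = (\<Sum>l<r. u l * (if l = i then f 0 else 0))"
      using True by (simp add: if_distrib cong: if_cong)
    also have "\<dots> = (\<Sum>l<r. u l * (\<Sum>j<t. W l j * x j)) + (\<Sum>l<r. u l * (\<Sum>b<3. \<alpha> l b * y b))"
      unfolding sum.distrib[symmetric] distrib_left[symmetric] using xy by simp
    also have "(\<Sum>l<r. u l * (\<Sum>j<t. W l j * x j)) = (\<Sum>j<t. mat_app t r (\<lambda>j i. W i j) u j * x j)"
      by (rule mat_app_pairing[symmetric])
    also have "(\<Sum>l<r. u l * (\<Sum>b<3. \<alpha> l b * y b)) = (\<Sum>a<3. mat_app 3 r (\<lambda>a i. \<alpha> i a) u a * y a)"
      by (rule mat_app_pairing[symmetric])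
    finally have "u i * f 0 = 0" unfolding assms(2,3) by simp
    then show ?thesis using f_nonzero[of 0] by simp
  next
    case False
    then show ?thesis using graded_vecs_outside[OF u] by simp
  qed
qed

text \<open>
  If a row \<open>u\<close> kills \<open>W\<close>, then \<open>u \<alpha>\<close> is a syzygy, as \<open>u \<alpha> f = u W g = 0\<close>.  So \<open>\<alpha>\<close> embeds the kernel of
  the transpose of \<open>W\<close> into the syzygies.
\<close>

lemma row_kernel_dim:
  "graded_dim {u \<in> graded_vecs r (\<lambda>i. - ds i) n. mat_app t r (\<lambda>j i. W i j) u = 0} \<le> graded_dim (syzygies (n + 3 * int d))"
proof -
  let ?L = "mat_app 3 r (\<lambda>a i. \<alpha> i a)"
  let ?U = "{u \<in> graded_vecs r (\<lambda>i. - ds i) n. mat_app t r (\<lambda>j i. W i j) u = 0}"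
  have sub: "fs.vs1.subspace ?U"
    using fs.vs1.subspace_inter[OF subspace_graded_vecs fs.linear_subspace_kernel[OF linear_mat_app]]
    by (simp add: Int_def)
  have "graded_dim ?U = graded_dim (?L ` ?U)"
    by (rule graded_dim_image_inj[OF linear_mat_app sub, of r "\<lambda>i. - ds i" n, symmetric]) (use row_kernel_trivial in auto)
  also have "graded_dim (?L ` ?U) \<le> graded_dim (syzygies (n + 3 * int d))"
  proof (rule graded_dim_mono[of _ _ 3 "\<lambda>_. int d" "n + 3 * int d"])
    show "syzygies (n + 3 * int d) \<subseteq> graded_vecs 3 (\<lambda>_. int d) (n + 3 * int d)" by (auto simp: syzygies_def)
    show "?L ` ?U \<subseteq> syzygies (n + 3 * int d)"
  proof clarify
    fix u :: "nat \<Rightarrow> 'a R" assume u: "u \<in> graded_vecs r (\<lambda>i. - ds i) n" "mat_app t r (\<lambda>j i. W i j) u = 0"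
    have "?L u \<in> graded_vecs 3 (\<lambda>_. - (2 * int d)) n"
      by (rule mat_app_graded[OF graded_mat_transpose[OF hom_\<alpha>] u(1)])
    then have "?L u \<in> graded_vecs 3 (\<lambda>_. int d) (n + 3 * int d)"
      by (simp add: graded_vecs_def algebra_simps)
    moreover have "(\<Sum>a<3. f a * ?L u a) = 0"
      using row_pairing[OF u(1)] unfolding u(2) by (simp add: mult.commute)
    ultimately show "?L u \<in> syzygies (n + 3 * int d)" by (simp add: syzygies_def)
  qed
  qed
  finally show ?thesis .
qed

text \<open>
  The cokernel of the transpose of \<open>W\<close> is concentrated in finitely many degrees.  The bound on its
  kernel, with the dimension of the syzygies known from the resolution, leaves exactly enough room
  for surjectivity once the sum of the degrees is known.
\<close>

lemma row_map_surjective: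
  obtains N where "\<And>n. n \<ge> N \<Longrightarrow>
    mat_app t r (\<lambda>j i. W i j) ` graded_vecs r (\<lambda>i. - ds i) n = graded_vecs t (\<lambda>j. - Ds j) n"
proof -
  define N where "N = (\<Sum>i<r. \<bar>ds i\<bar>) + (\<Sum>j<t. \<bar>Ds j\<bar>)"
  have nn: "0 \<le> (\<Sum>i<r. \<bar>ds i\<bar>)" "0 \<le> (\<Sum>j<t. \<bar>Ds j\<bar>)" by (simp_all add: sum_nonneg)
  have Nds: "\<bar>ds i\<bar> \<le> N" if "i < r" for i
  proof -
    have "\<bar>ds i\<bar> \<le> (\<Sum>i<r. \<bar>ds i\<bar>)" by (rule member_le_sum) (use that in auto)
    then show ?thesis unfolding N_def using nn by linarith
  qed
  have NDs: "\<bar>Ds i\<bar> \<le> N" if "i < t" for i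
  proof -
    have "\<bar>Ds i\<bar> \<le> (\<Sum>j<t. \<bar>Ds j\<bar>)" by (rule member_le_sum) (use that in auto)
    then show ?thesis unfolding N_def using nn by linarith
  qed
  show ?thesis
  proof (rule that)
    fix n assume n: "n \<ge> N"
    let ?F = "graded_vecs r (\<lambda>i. - ds i) n :: (nat \<Rightarrow> 'a R) set"
    let ?G = "graded_vecs t (\<lambda>j. - Ds j) n :: (nat \<Rightarrow> 'a R) set"
    let ?M = "mat_app t r (\<lambda>j i. W i j)"
    let ?q = "\<lambda>n::int. n^2 + 3 * n + 2"
    let ?d2 = "\<Sum>i<r. (ds i)^2" and ?D2 = "\<Sum>j<t. (Ds j)^2"
    let ?s = "\<Sum>i<r. ds i" and ?S = "\<Sum>j<t. Ds j"
    have m: "n - (- ds i) \<ge> -2" "n + 3 * int d - ds i \<ge> -2" if "i < r" for i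
      using Nds[OF that] n by linarith+
    have M: "n - (- Ds i) \<ge> -2" "n + 3 * int d - Ds i \<ge> -2" if "i < t" for i
      using NDs[OF that] n by linarith+
    have F: "2 * int (graded_dim ?F) = int r * ?q n + (2 * n + 3) * ?s + ?d2"
      unfolding graded_dim_graded_vecs using sum_monomial_count[of r n "\<lambda>i. - ds i"] m(1) by (simp add: sum_negf)
    have G: "2 * int (graded_dim ?G) = int t * ?q n + (2 * n + 3) * ?S + ?D2"
      unfolding graded_dim_graded_vecs using sum_monomial_count[of t n "\<lambda>i. - Ds i"] M(1) by (simp add: sum_negf)
    let ?n = "n + 3 * int d"
    have dim_syz: "2 * int (graded_dim (syzygies ?n)) = (int r * ?q ?n - (2 * ?n + 3) * ?s + ?d2) - (int t * ?q ?n - (2 * ?n + 3) * ?S + ?D2)"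
    proof -
      have "int (graded_dim (syzygies ?n)) = int (\<Sum>i<r. monomial_count (?n - ds i)) - int (\<Sum>j<t. monomial_count (?n - Ds j))"
        using graded_dim_syzygies[of ?n] by linarith
      then have "2 * int (graded_dim (syzygies ?n)) = 2 * int (\<Sum>i<r. monomial_count (?n - ds i)) - 2 * int (\<Sum>j<t. monomial_count (?n - Ds j))"
        by simp
      also have "2 * int (\<Sum>i<r. monomial_count (?n - ds i)) = int r * ?q ?n - (2 * ?n + 3) * ?s + ?d2"
        by (rule sum_monomial_count) (rule m(2))
      also have "2 * int (\<Sum>j<t. monomial_count (?n - Ds j)) = int t * ?q ?n - (2 * ?n + 3) * ?S + ?D2"
        by (rule sum_monomial_count) (rule M(2))
      finally show ?thesis .
    qed
    have rn: "graded_dim ?F = graded_dim {u \<in> ?F. ?M u = 0} + graded_dim (?M ` ?F)"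
      by (rule graded_rank_nullity[OF linear_mat_app subspace_graded_vecs order_refl])
    have "int (graded_dim ?F) \<le> int (graded_dim (syzygies ?n)) + int (graded_dim (?M ` ?F))"
      using rn row_kernel_dim[of n] by linarith
    moreover have "2 * int (graded_dim ?F) = 2 * int (graded_dim (syzygies ?n)) + 2 * int (graded_dim ?G)"
      unfolding F G dim_syz by (rule euler_characteristic_symmetry[OF degree_sum]) (simp add: rank)
    ultimately have le: "graded_dim ?G \<le> graded_dim (?M ` ?F)" by linarith
    show "?M ` ?F = ?G"
    proof (rule subspace_eq_graded[OF _ _ le])
      show "fs.vs1.subspace (?M ` ?F)"
        by (rule fs.linear_subspace_image[OF linear_mat_app subspace_graded_vecs])
      show "?M ` ?F \<subseteq> ?G" using mat_app_graded[OF graded_mat_transpose[OF hom_W]] by blast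
    qed
  qed
qed

text \<open>
  If \<open>x e\<^sub>j = u W\<close> for a monomial \<open>x\<close>, then \<open>x g\<^sub>j = u W g = u \<alpha> f\<close>, which is a combination of the forms.
\<close>

lemma high_degree_multiple_in_ideal:
  assumes j: "j < t"
  obtains K where "\<And>p. (\<And>m. m \<in> Poly_Mapping.keys p \<Longrightarrow> K \<le> mon_deg m) \<Longrightarrow> \<exists>c. p * g j = (\<Sum>a<3. c a * f a)"
proof -
  obtain N where N: "\<And>n. n \<ge> N \<Longrightarrow>
    mat_app t r (\<lambda>j i. W i j) ` graded_vecs r (\<lambda>i. - ds i) n = graded_vecs t (\<lambda>j. - Ds j) n"
    using row_map_surjective by blast
  have mon: "\<exists>c. Poly_Mapping.single m v * g j = (\<Sum>a<3. c a * f a)" if "nat (N + Ds j) \<le> mon_deg m" for m v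
  proof -
    let ?n = "int (mon_deg m) - Ds j"
    define x where "x = (\<lambda>l. if l = j then Poly_Mapping.single m v else 0)"
    have "x \<in> graded_vecs t (\<lambda>j. - Ds j) ?n"
      using j homogeneous_single[of m v] by (auto simp: graded_vecs_def x_def)
    moreover have "?n \<ge> N" using that by linarith
    ultimately obtain u where u: "u \<in> graded_vecs r (\<lambda>i. - ds i) ?n" "x = mat_app t r (\<lambda>j i. W i j) u"
      using N by blast
    have "Poly_Mapping.single m v * g j = (\<Sum>l<t. x l * g l)"
      using j by (simp add: x_def if_distrib[of "\<lambda>y. y * _"] cong: if_cong)
    also have "\<dots> = (\<Sum>a<3. mat_app 3 r (\<lambda>a i. \<alpha> i a) u a * f a)"
      unfolding u(2) by (rule row_pairing[OF u(1)])
    finally show ?thesis by (intro exI)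
  qed
  show ?thesis
  proof (rule that)
    fix p :: "'a R" assume p: "\<And>m. m \<in> Poly_Mapping.keys p \<Longrightarrow> nat (N + Ds j) \<le> mon_deg m"
    have "\<forall>m. \<exists>c. m \<in> Poly_Mapping.keys p \<longrightarrow>
        Poly_Mapping.single m (Poly_Mapping.lookup p m) * g j = (\<Sum>a<3. c a * f a)"
      using mon p by blast
    then obtain c where c: "\<And>m. m \<in> Poly_Mapping.keys p \<Longrightarrow>
        Poly_Mapping.single m (Poly_Mapping.lookup p m) * g j = (\<Sum>a<3. c m a * f a)" by metis
    have "p * g j = (\<Sum>m\<in>Poly_Mapping.keys p. Poly_Mapping.single m (Poly_Mapping.lookup p m)) * g j"
      by (simp flip: poly_mapping_eq_sum_single[of p])
    also have "\<dots> = (\<Sum>m\<in>Poly_Mapping.keys p. \<Sum>a<3. c m a * f a)"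
      unfolding sum_distrib_right by (rule sum.cong) (auto simp: c)
    also have "\<dots> = (\<Sum>a<3. (\<Sum>m\<in>Poly_Mapping.keys p. c m a) * f a)"
      unfolding sum_distrib_right by (rule sum.swap)
    finally show "\<exists>c. p * g j = (\<Sum>a<3. c a * f a)" by (intro exI)
  qed
qed

end

lemma keys_ideal_le:
  assumes "\<And>p. p \<in> A \<Longrightarrow> \<forall>m\<in>Poly_Mapping.keys p. K \<le> mon_deg m" "p \<in> ideal_of (A :: 'k::field R set)"
  shows "\<forall>m\<in>Poly_Mapping.keys p. K \<le> mon_deg m"
proof -
  let ?S = "{p :: 'k R. \<forall>m\<in>Poly_Mapping.keys p. K \<le> mon_deg m}"
  have "is_ideal ?S"
    unfolding module.subspace_def[OF module_times]
  proof (intro conjI ballI allI)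
    fix p q assume pq: "p \<in> ?S" "q \<in> ?S"
    then show "p + q \<in> ?S" using keys_add[of p q] by auto
  next
    fix c p assume p: "p \<in> ?S"
    show "c * p \<in> ?S"
    proof (rule CollectI, rule ballI)
      fix m assume "m \<in> Poly_Mapping.keys (c * p)"
      then obtain a b where "m = a + b" "b \<in> Poly_Mapping.keys p" using keys_mult by blast
      then show "K \<le> mon_deg m" using p by (auto simp: mon_deg_add)
    qed
  qed simp
  moreover have "A \<subseteq> ?S" using assms(1) by auto
  ultimately show ?thesis using module.span_minimal[OF module_times, of A ?S] assms(2) by auto
qed

lemma keys_max_ideal: "p \<in> max_ideal \<Longrightarrow> \<forall>m\<in>Poly_Mapping.keys p. 1 \<le> mon_deg m"
  unfolding max_ideal_def
  by (rule keys_ideal_le) (auto simp: var_def mon_deg_eq lookup_single when_def exhaust_type_3 split: if_splits)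

lemma lookup_max_ideal_0: "p \<in> max_ideal \<Longrightarrow> Poly_Mapping.lookup p 0 = 0"
  using keys_max_ideal[of p] by (force simp: in_keys_iff)

lemma keys_max_ideal_power:
  fixes p :: "'k::field R"
  shows "p \<in> ideal_power max_ideal K \<Longrightarrow> \<forall>m\<in>Poly_Mapping.keys p. K \<le> mon_deg m"
proof (induction K arbitrary: p)
  case (Suc K)
  show ?case
  proof (rule keys_ideal_le[OF _ Suc.prems[unfolded ideal_power.simps]], clarify)
    fix a b :: "'k R" and m :: "3 \<Rightarrow>\<^sub>0 nat" assume ab: "a \<in> max_ideal" "b \<in> ideal_power max_ideal K" "m \<in> Poly_Mapping.keys (a * b)"
    then obtain u v where "m = u + v" "u \<in> Poly_Mapping.keys a" "v \<in> Poly_Mapping.keys b" using keys_mult by blast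
    moreover from this have "1 \<le> mon_deg u" "K \<le> mon_deg v"
      using keys_max_ideal[OF ab(1)] Suc.IH[OF ab(2)] by blast+
    ultimately show "Suc K \<le> mon_deg m" by (simp add: mon_deg_add)
  qed
qed simp

text \<open>
  The entry \<open>g\<^sub>j\<close> of the comparison map is a form of degree \<open>3 d - D\<^sub>j\<close> in the saturation of \<open>I\<close> that does
  not lie in \<open>I\<close>.
\<close>

theorem (in three_form_resolution) last_degree_le:
  assumes I: "I = {\<Sum>a<3. c a * f a | c. True}"
    and sat: "\<And>p \<mu>. p \<in> saturation I \<Longrightarrow> \<mu> \<le> d \<Longrightarrow> homogeneous (int \<mu>) p \<Longrightarrow> p \<in> I"
    and j: "j < t"
  shows "Ds j \<le> 2 * int d - 1"
proof (rule ccontr)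
  assume n: "\<not> Ds j \<le> 2 * int d - 1"
  obtain \<alpha> g where ag: "graded_mat r ds 3 (\<lambda>_. 2 * int d) \<alpha>"
    "\<And>a l. a < 3 \<Longrightarrow> l < 3 \<Longrightarrow> (\<Sum>i<r. V a i * \<alpha> i l) = koszul a l"
    "g \<in> graded_vecs t Ds (3 * int d)"
    "\<And>i. i < r \<Longrightarrow> (\<Sum>l<3. \<alpha> i l * f l) = (\<Sum>j<t. W i j * g j)"
    using koszul_lift_ex by blast
  interpret koszul_comparison f V W d r t ds Ds \<alpha> g
    by unfold_locales (use ag in auto)
  have notI: "g j \<notin> I" using g_notin_ideal[OF j] by (auto simp: I)
  have hom: "homogeneous (3 * int d - Ds j) (g j)" using graded_vecsD[OF hom_g j] .
  have "3 * int d - Ds j \<ge> 0"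
  proof (rule ccontr)
    assume "\<not> ?thesis"
    then have "g j = 0" using homogeneous_neg[OF hom] by simp
    also have "0 = (\<Sum>a<3. (\<lambda>_. 0) a * f a)" by simp
    also have "\<dots> \<in> I" unfolding I by (rule CollectI, rule exI[of _ "\<lambda>_. 0"]) simp
    finally show False using notI by simp
  qed
  then have "homogeneous (int (nat (3 * int d - Ds j))) (g j)" using hom by simp
  moreover have "nat (3 * int d - Ds j) \<le> d" using n by linarith
  moreover have "g j \<in> saturation I"
  proof -
    obtain K where K: "\<And>p. (\<And>m. m \<in> Poly_Mapping.keys p \<Longrightarrow> K \<le> mon_deg m) \<Longrightarrow> \<exists>c. p * g j = (\<Sum>a<3. c a * f a)"
      using high_degree_multiple_in_ideal[OF j] by blast
    have "g j \<in> colon I (ideal_power max_ideal K)"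
      unfolding colon_def
    proof (rule CollectI, rule ballI)
      fix p :: "'k R" assume "p \<in> ideal_power max_ideal K"
      then have "\<exists>c. p * g j = (\<Sum>a<3. c a * f a)" using keys_max_ideal_power by (intro K) blast
      then show "g j * p \<in> I" by (auto simp: I mult.commute)
    qed
    then show ?thesis unfolding saturation_def by blast
  qed
  ultimately show False using sat notI by blast
qed

section \<open>Degree lists\<close>

lemma card_filter_nth: "card {i. i < length xs \<and> P (xs ! i)} = length (filter P xs)"
  by (simp add: length_filter_conv_card)

lemma length_filter_sort: "length (filter P (sort xs)) = length (filter P xs)"
  by (metis mset_filter mset_sort size_mset)

text \<open>
  The gap condition, applied to the set of all columns of degree at most the \<open>m\<close>-th smallest one.
\<close>

lemma sorted_degree_gap:
  fixes xs ys :: "int list"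
  assumes len: "length xs = length ys + 2"
    and gap: "\<And>S. S \<subseteq> {..<length ys} \<Longrightarrow> S \<noteq> {} \<Longrightarrow>
       card S + 2 \<le> card {i. i < length xs \<and> (\<exists>j\<in>S. xs ! i < ys ! j)}"
    and m: "m < length ys"
  shows "sort xs ! (m + 2) < sort ys ! m"
proof (rule ccontr)
  define v where "v = sort ys ! m"
  assume "\<not> ?thesis"
  then have v: "v \<le> sort xs ! (m + 2)" by (simp add: v_def)
  let ?S = "{j. j < length ys \<and> ys ! j \<le> v}"
  have "card {j. j < length (sort ys) \<and> sort ys ! j \<le> v} = card ?S"
    unfolding card_filter_nth[of ys "\<lambda>y. y \<le> v"] card_filter_nth[of "sort ys" "\<lambda>y. y \<le> v"]
    by (rule length_filter_sort)
  \<comment> \<open>There are at least \<open>m + 1\<close> such columns; if the claim fails, there are fewer than \<open>m + 3\<close> rows of degree below \<open>v\<close>.\<close>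
  moreover have "{..m} \<subseteq> {j. j < length (sort ys) \<and> sort ys ! j \<le> v}"
    using m by (auto simp: v_def intro!: sorted_nth_mono)
  ultimately have S: "m + 1 \<le> card ?S"
    using card_mono[of "{j. j < length (sort ys) \<and> sort ys ! j \<le> v}" "{..m}"] by simp
  then have "?S \<noteq> {}" by (metis (no_types) add_is_0 card.empty le_zero_eq one_neq_zero)
  then have "card ?S + 2 \<le> card {i. i < length xs \<and> (\<exists>j\<in>?S. xs ! i < ys ! j)}" by (intro gap) auto
  also have "\<dots> \<le> card {i. i < length xs \<and> xs ! i < v}" by (intro card_mono) auto
  also have "\<dots> = card {i. i < length (sort xs) \<and> sort xs ! i < v}"
    unfolding card_filter_nth[of xs "\<lambda>y. y < v"] card_filter_nth[of "sort xs" "\<lambda>y. y < v"]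
    by (rule length_filter_sort[symmetric])
  also have "\<dots> \<le> card {..<m + 2}"
  proof (rule card_mono)
    show "{i. i < length (sort xs) \<and> sort xs ! i < v} \<subseteq> {..<m + 2}"
    proof (rule subsetI, rule ccontr)
      fix i assume "i \<in> {i. i < length (sort xs) \<and> sort xs ! i < v}" "i \<notin> {..<m + 2}"
      then have i: "i < length (sort xs)" "sort xs ! i < v" "i \<notin> {..<m + 2}" by auto
      then have "sort xs ! (m + 2) \<le> sort xs ! i" by (intro sorted_nth_mono) auto
      then show False using i v by simp
    qed
  qed simp
  finally show False using S by simp
qed

text \<open>
  Pairing \<open>ys ! m\<close> with \<open>xs ! (m + 2)\<close> leaves the two smallest entries of \<open>xs\<close> to account for
  \<open>3 d + length ys\<close>, while each of them is at most \<open>2 d - 2\<close>.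
\<close>

lemma degree_lists:
  fixes xs ys :: "int list" and d :: int
  assumes len: "length xs = length ys + 2" "length ys \<ge> 1"
    and gap: "\<And>m. m < length ys \<Longrightarrow> xs ! (m + 2) < ys ! m"
    and top: "\<And>m. m < length ys \<Longrightarrow> ys ! m \<le> 2 * d - 1"
    and sorted: "sorted xs" and sum: "sum_list xs = 3 * d + sum_list ys"
  shows "int (length ys) \<le> d - 4"
proof -
  have "sum_list xs = (\<Sum>i<length ys + 2. xs ! i)" by (simp add: sum_list_sum_nth len atLeast0LessThan)
  also have "\<dots> = xs ! 0 + xs ! 1 + (\<Sum>i<length ys. xs ! (i + 2))"
    by (simp add: sum.lessThan_Suc_shift numeral_2_eq_2 del: sum.lessThan_Suc)
  also have "(\<Sum>i<length ys. xs ! (i + 2)) \<le> (\<Sum>i<length ys. ys ! i - 1)"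
    using gap by (intro sum_mono) force
  also have "\<dots> = sum_list ys - int (length ys)"
    by (simp add: sum_list_sum_nth atLeast0LessThan sum_subtractf)
  finally have "3 * d + int (length ys) \<le> xs ! 0 + xs ! 1" using sum by linarith
  moreover have "xs ! 0 \<le> xs ! 2" "xs ! 1 \<le> xs ! 2"
    using sorted len by (auto intro!: sorted_nth_mono)
  moreover have "xs ! 2 \<le> 2 * d - 2" 
  proof -
    have "0 < length ys" using len by linarith
    then have "xs ! 2 < ys ! 0" "ys ! 0 \<le> 2 * d - 1"
      using gap[of 0] top[of 0] by (simp_all add: numeral_2_eq_2)
    then show ?thesis by linarith
  qed
  ultimately show ?thesis by linarith
qed

lemma degree_lists_5:
  fixes xs ys :: "int list"
  assumes len: "length xs = length ys + 2" "length ys \<ge> 1"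
    and gap: "\<And>m. m < length ys \<Longrightarrow> xs ! (m + 2) < ys ! m"
    and top: "\<And>m. m < length ys \<Longrightarrow> ys ! m \<le> 9"
    and sorted: "sorted xs" and sum: "sum_list xs = 15 + sum_list ys"
  shows "xs = [8, 8, 8] \<and> ys = [9]"
proof -
  have "length ys = 1" using degree_lists[of xs ys 5] assms by simp
  then obtain D where ys: "ys = [D]" by (auto simp: length_Suc_conv)
  then have "length xs = Suc (Suc (Suc 0))" using len by simp
  then obtain a b c where xs: "xs = [a, b, c]" by (auto simp: length_Suc_conv)
  show ?thesis using gap[of 0] top[of 0] sorted sum unfolding xs ys by auto
qed

lemma degree_lists_6:
  fixes xs ys :: "int list"
  assumes len: "length xs = length ys + 2" "length ys \<ge> 1"
    and gap: "\<And>m. m < length ys \<Longrightarrow> xs ! (m + 2) < ys ! m"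
    and top: "\<And>m. m < length ys \<Longrightarrow> ys ! m \<le> 11"
    and sorted: "sorted xs" and sum: "sum_list xs = 18 + sum_list ys"
  shows "(xs = [10, 10, 10, 10] \<and> ys = [11, 11]) \<or> (xs = [9, 10, 10] \<and> ys = [11])"
proof -
  have "length ys \<le> 2" using degree_lists[of xs ys 6] assms by simp
  then consider "length ys = 1" | "length ys = 2" using len by linarith
  then show ?thesis
  proof cases
    case 1
    then obtain D where ys: "ys = [D]" by (auto simp: length_Suc_conv)
    then have "length xs = Suc (Suc (Suc 0))" using len by simp
    then obtain a b c where xs: "xs = [a, b, c]" by (auto simp: length_Suc_conv)
    have "c < D" "D \<le> 11" "a \<le> b" "b \<le> c" "a + b + c = 18 + D"
      using gap[of 0] top[of 0] sorted sum unfolding xs ys by auto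
    moreover from this have "b \<ge> 10" by linarith
    ultimately have "a = 9 \<and> b = 10 \<and> c = 10 \<and> D = 11" by linarith
    then show ?thesis by (simp add: xs ys)
  next
    case 2
    then obtain D E where ys: "ys = [D, E]" by (auto simp: length_Suc_conv numeral_2_eq_2)
    then have "length xs = Suc (Suc (Suc (Suc 0)))" using len by simp
    then obtain a b c e where xs: "xs = [a, b, c, e]" by (auto simp: length_Suc_conv)
    have "c < D" "e < E" "D \<le> 11" "E \<le> 11" "a \<le> b" "b \<le> c" "c \<le> e" "a + b + c + e = 18 + D + E"
      using gap[of 0] gap[of 1] top[of 0] top[of 1] sorted sum unfolding xs ys by auto
    then have "a = 10 \<and> b = 10 \<and> c = 10 \<and> e = 10 \<and> D = 11 \<and> E = 11" by linarith
    then show ?thesis by (simp add: xs ys)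
  qed
qed

lemma degree_lists_7:
  fixes xs ys :: "int list"
  assumes len: "length xs = length ys + 2" "length ys \<ge> 1"
    and gap: "\<And>m. m < length ys \<Longrightarrow> xs ! (m + 2) < ys ! m"
    and top: "\<And>m. m < length ys \<Longrightarrow> ys ! m \<le> 13"
    and sorted: "sorted xs" and sum: "sum_list xs = 21 + sum_list ys"
  shows "(xs = [12, 12, 12, 12, 12] \<and> ys = [13, 13, 13]) \<or> (xs = [11, 12, 12, 12] \<and> ys = [13, 13]) \<or>
    (xs = [11, 11, 12] \<and> ys = [13]) \<or> (xs = [11, 11, 11] \<and> ys = [12]) \<or> (xs = [10, 12, 12] \<and> ys = [13])"
proof -
  have "length ys \<le> 3" using degree_lists[of xs ys 7] assms by simp
  then consider "length ys = 1" | "length ys = 2" | "length ys = 3" using len by linarith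
  then show ?thesis
  proof cases
    case 1
    then obtain D where ys: "ys = [D]" by (auto simp: length_Suc_conv)
    then have "length xs = Suc (Suc (Suc 0))" using len by simp
    then obtain a b c where xs: "xs = [a, b, c]" by (auto simp: length_Suc_conv)
    have "c < D" "D \<le> 13" "a \<le> b" "b \<le> c" "a + b + c = 21 + D"
      using gap[of 0] top[of 0] sorted sum unfolding xs ys by auto
    then have l: "c < D" "D \<le> 13" "a \<le> b" "b \<le> c" "a + b + c = 21 + D" by blast+
    then have "11 \<le> b" "b \<le> 12" by linarith+
    then consider "b = 11" | "b = 12" by linarith
    then show ?thesis
    proof cases
      case 1
      with l have "a = 11" "D = c + 1" by linarith+
      moreover have "c = 11 \<or> c = 12" using l 1 by linarith
      ultimately show ?thesis using 1 by (auto simp: xs ys)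
    next
      case 2
      with l have "c = 12" "D = 13" "a = 10" by linarith+
      with 2 show ?thesis by (simp add: xs ys)
    qed
  next
    case 2
    then obtain D E where ys: "ys = [D, E]" by (auto simp: length_Suc_conv numeral_2_eq_2)
    then have "length xs = Suc (Suc (Suc (Suc 0)))" using len by simp
    then obtain a b c e where xs: "xs = [a, b, c, e]" by (auto simp: length_Suc_conv)
    have "c < D" "e < E" "D \<le> 13" "E \<le> 13" "a \<le> b" "b \<le> c" "c \<le> e" "a + b + c + e = 21 + D + E"
      using gap[of 0] gap[of 1] top[of 0] top[of 1] sorted sum unfolding xs ys by auto
    moreover from this have "b \<ge> 12" by linarith
    ultimately have "a = 11 \<and> b = 12 \<and> c = 12 \<and> e = 12 \<and> D = 13 \<and> E = 13" by linarith
    then show ?thesis by (simp add: xs ys)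
  next
    case 3
    then obtain D E F where ys: "ys = [D, E, F]" by (auto simp: length_Suc_conv numeral_3_eq_3)
    then have "length xs = Suc (Suc (Suc (Suc (Suc 0))))" using len by simp
    then obtain a b c e f where xs: "xs = [a, b, c, e, f]" by (auto simp: length_Suc_conv)
    have "c < D" "e < E" "f < F" "D \<le> 13" "E \<le> 13" "F \<le> 13" "a \<le> b" "b \<le> c" "c \<le> e" "e \<le> f" "a + b + c + e + f = 21 + D + E + F"
      using gap[of 0] gap[of 1] gap[of 2] top[of 0] top[of 1] top[of 2] sorted sum unfolding xs ys by auto
    then have "a = 12 \<and> b = 12 \<and> c = 12 \<and> e = 12 \<and> f = 12 \<and> D = 13 \<and> E = 13 \<and> F = 13" by linarith
    then show ?thesis by (simp add: xs ys)
  qed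
qed

section \<open>Resolutions given by matrices\<close>

lemma mult_mat_vec_vec:
  assumes "A \<in> carrier_mat m n"
  shows "A *\<^sub>v vec n z = vec m (\<lambda>i. \<Sum>j<n. A $$ (i, j) * z j)"
  using assms by (intro eq_vecI) (auto simp: scalar_prod_def atLeast0LessThan)

lemma mat_image_eq:
  assumes "A \<in> carrier_mat m n"
  shows "v \<in> mat_image A \<longleftrightarrow> (\<exists>z. v = vec m (\<lambda>i. \<Sum>j<n. A $$ (i, j) * z j))"
proof
  assume "v \<in> mat_image A"
  then obtain w where w: "w \<in> carrier_vec n" "v = A *\<^sub>v w" using assms by (auto simp: mat_image_def)
  then have "w = vec n (\<lambda>j. w $ j)" by auto
  then have "v = vec m (\<lambda>i. \<Sum>j<n. A $$ (i, j) * w $ j)"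
    using w(2) mult_mat_vec_vec[OF assms, of "\<lambda>j. w $ j"] by simp
  then show "\<exists>z. v = vec m (\<lambda>i. \<Sum>j<n. A $$ (i, j) * z j)" by blast
next
  assume "\<exists>z. v = vec m (\<lambda>i. \<Sum>j<n. A $$ (i, j) * z j)"
  then obtain z where "v = A *\<^sub>v vec n z" using mult_mat_vec_vec[OF assms] by metis
  moreover have "vec n z \<in> carrier_vec (dim_col A)" using assms by auto
  ultimately show "v \<in> mat_image A" unfolding mat_image_def by blast
qed

lemma vec_in_kernel_iff:
  assumes "A \<in> carrier_mat m n"
  shows "vec n z \<in> mat_kernel A \<longleftrightarrow> (\<forall>i<m. (\<Sum>j<n. A $$ (i, j) * z j) = 0)"
proof -
  have "vec n z \<in> mat_kernel A \<longleftrightarrow> A *\<^sub>v vec n z = 0\<^sub>v m" by (simp add: mat_kernel[OF assms])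
  then show ?thesis unfolding mult_mat_vec_vec[OF assms] by (auto simp: vec_eq_iff)
qed

lemma kernel_eq_image_lift:
  assumes "A \<in> carrier_mat m n" "B \<in> carrier_mat n s" "mat_kernel A = mat_image B"
    and "\<forall>i<m. (\<Sum>j<n. A $$ (i, j) * z j) = 0"
  shows "\<exists>w. \<forall>j<n. z j = (\<Sum>l<s. B $$ (j, l) * w l)"
proof -
  have "vec n z \<in> mat_kernel A" using assms(4) vec_in_kernel_iff[OF assms(1)] by blast
  then obtain w where w: "vec n z = vec n (\<lambda>j. \<Sum>l<s. B $$ (j, l) * w l)"
    unfolding assms(3) mat_image_eq[OF assms(2)] by blast
  have "z j = (\<Sum>l<s. B $$ (j, l) * w l)" if "j < n" for j
    using arg_cong[OF w, of "\<lambda>v. v $ j"] that by simp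
  then show ?thesis by blast
qed

lemma kernel_eq_image_comp:
  assumes "A \<in> carrier_mat m n" "B \<in> carrier_mat n s" "mat_kernel A = mat_image B" "i < m" "l < s"
  shows "(\<Sum>j<n. A $$ (i, j) * B $$ (j, l)) = 0"
proof -
  have "vec n (\<lambda>j. \<Sum>k<s. B $$ (j, k) * (if k = l then 1 else 0)) \<in> mat_image B"
    unfolding mat_image_eq[OF assms(2)] by (rule exI) (rule refl)
  moreover have "(\<lambda>j. \<Sum>k<s. B $$ (j, k) * (if k = l then 1 else 0)) = (\<lambda>j. B $$ (j, l))"
    using assms(5) by (auto simp: if_distrib cong: if_cong)
  ultimately have "vec n (\<lambda>j. B $$ (j, l)) \<in> mat_kernel A" using assms(3) by simp
  then show ?thesis unfolding vec_in_kernel_iff[OF assms(1)] using assms(4) by blast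
qed

lemma indeg_quotient_ge:
  assumes "indeg_quotient J I \<ge> enat (d + 1)" "is_ideal I" "p \<in> J" "\<mu> \<le> d" "homogeneous (int \<mu>) p"
  shows "p \<in> I"
proof -
  have "quotient_piece J I \<mu> = {I}"
  proof (rule ccontr)
    assume "quotient_piece J I \<mu> \<noteq> {I}"
    then have "indeg_quotient J I \<le> enat \<mu>" unfolding indeg_quotient_def by (intro INF_lower) auto
    then have "enat (d + 1) \<le> enat \<mu>" using assms(1) order_trans by blast
    then show False using assms(4) by simp
  qed
  moreover have "(+) p ` I \<in> quotient_piece J I \<mu>" using assms(3,5) unfolding quotient_piece_def by blast
  ultimately have "(+) p ` I \<in> {I}" by (simp only:)
  then have "(+) p ` I = I" by simp
  moreover have "p + 0 \<in> (+) p ` I" by (rule imageI) (rule module.subspace_0[OF module_times assms(2)])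
  ultimately show ?thesis by simp
qed

text \<open>
  The forms are the entries of the first matrix of the resolution; they generate \<open>I\<close> by exactness and
  take over the role of the given generators.
\<close>

lemma resolution_of_length_3:
  assumes res: "minimal_graded_free_resolution I [[0], replicate 3 (int d), ds, Ds] \<phi>s"
    and codim: "codim I = 2" and len: "length ds = length Ds + 2"
  obtains f V W where
    "three_form_resolution f V W d (length ds) (length Ds) (\<lambda>i. ds ! i) (\<lambda>j. Ds ! j)"
    "I = {\<Sum>a<3. c a * f a | c. True}"
proof -
  let ?Fs = "[[0], replicate 3 (int d), ds, Ds]"
  have "length \<phi>s = 3" using res by (simp add: minimal_graded_free_resolution_def)
  then obtain A B C where \<phi>s: "\<phi>s = [A, B, C]" by (auto simp: length_Suc_conv numeral_3_eq_3)
  have gh: "\<forall>i<3. graded_hom (?Fs ! Suc i) (?Fs ! i) (\<phi>s ! i)"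
    and im0: "resolution_image ?Fs \<phi>s 0 = {v \<in> carrier_vec 1. v $ 0 \<in> I}"
    and ker: "\<forall>i<3. mat_kernel (\<phi>s ! i) = resolution_image ?Fs \<phi>s (Suc i)"
    and min: "\<forall>i<3. elements_mat (\<phi>s ! i) \<subseteq> max_ideal"
    using res unfolding minimal_graded_free_resolution_def by (auto simp: \<phi>s)
  have ghA: "graded_hom (replicate 3 (int d)) [0] A" and ghB: "graded_hom ds (replicate 3 (int d)) B"
    and ghC: "graded_hom Ds ds C"
    using gh unfolding all_less_3 by (simp_all add: \<phi>s)
  have imA: "mat_image A = {v \<in> carrier_vec 1. v $ 0 \<in> I}"
    using im0 by (simp add: resolution_image_def \<phi>s)
  have kerA: "mat_kernel A = mat_image B" and kerB: "mat_kernel B = mat_image C"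
    and kerC: "mat_kernel C = {0\<^sub>v (length Ds)}"
    using ker unfolding all_less_3 by (simp_all add: resolution_image_def \<phi>s)
  have minB: "elements_mat B \<subseteq> max_ideal" and minC: "elements_mat C \<subseteq> max_ideal"
    using min unfolding all_less_3 by (simp_all add: \<phi>s)
  have cA: "A \<in> carrier_mat 1 3" and cB: "B \<in> carrier_mat 3 (length ds)"
    and cC: "C \<in> carrier_mat (length ds) (length Ds)"
    using ghA ghB ghC by (simp_all add: graded_hom_def)
  define f where "f = (\<lambda>a. A $$ (0, a))"
  define V where "V = (\<lambda>a i. B $$ (a, i))"
  define W where "W = (\<lambda>i j. C $$ (i, j))"
  have I: "I = {\<Sum>a<3. c a * f a | c. True}"
  proof (intro Set.set_eqI iffI)
    fix x assume "x \<in> I"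
    then have "vec 1 (\<lambda>_. x) \<in> mat_image A" by (simp add: imA)
    then obtain z where z: "vec 1 (\<lambda>_. x) = vec 1 (\<lambda>i. \<Sum>j<3. A $$ (i, j) * z j)"
      unfolding mat_image_eq[OF cA] by blast
    have "x = (\<Sum>a<3. z a * f a)" using arg_cong[OF z, of "\<lambda>v. v $ 0"] by (simp add: f_def mult.commute)
    then show "x \<in> {\<Sum>a<3. c a * f a | c. True}" by blast
  next
    fix x assume "x \<in> {\<Sum>a<3. c a * f a | c. True}"
    then obtain c where c: "x = (\<Sum>a<3. c a * f a)" by blast
    have "vec 1 (\<lambda>i. \<Sum>j<3. A $$ (i, j) * c j) \<in> mat_image A"
      unfolding mat_image_eq[OF cA] by (rule exI) (rule refl)
    then show "x \<in> I" by (simp add: imA c f_def mult.commute)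
  qed
  have "three_form_resolution f V W d (length ds) (length Ds) (\<lambda>i. ds ! i) (\<lambda>j. Ds ! j)"
  proof
    show "homogeneous (int d) (f a)" if "a < 3" for a
      using ghA that by (simp add: graded_hom_def f_def)
    show "graded_mat 3 (\<lambda>_. int d) (length ds) (\<lambda>i. ds ! i) V"
      using ghB by (simp add: graded_hom_def graded_mat_def V_def)
    show "graded_mat (length ds) (\<lambda>i. ds ! i) (length Ds) (\<lambda>j. Ds ! j) W"
      using ghC by (simp add: graded_hom_def graded_mat_def W_def)
    show "(\<Sum>a<3. f a * V a i) = 0" if "i < length ds" for i
      unfolding f_def V_def by (rule kernel_eq_image_comp[OF cA cB kerA _ that]) simp
    show "(\<Sum>i<length ds. V a i * W i j) = 0" if "a < 3" "j < length Ds" for a j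
      unfolding V_def W_def by (rule kernel_eq_image_comp[OF cB cC kerB that])
    show "\<exists>w. \<forall>a<3. z a = (\<Sum>i<length ds. V a i * w i)" if "(\<Sum>a<3. f a * z a) = 0" for z
      unfolding V_def by (rule kernel_eq_image_lift[OF cA cB kerA]) (use that in \<open>simp add: f_def\<close>)
    show "\<exists>x. \<forall>i<length ds. w i = (\<Sum>j<length Ds. W i j * x j)"
      if "\<forall>a<3. (\<Sum>i<length ds. V a i * w i) = 0" for w
      unfolding W_def by (rule kernel_eq_image_lift[OF cB cC kerB]) (use that in \<open>simp add: V_def\<close>)
    show "\<forall>j<length Ds. x j = 0" if "\<forall>i<length ds. (\<Sum>j<length Ds. W i j * x j) = 0" for x
    proof -
      have "vec (length Ds) x \<in> mat_kernel C"
        unfolding vec_in_kernel_iff[OF cC] using that by (simp add: W_def)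
      then have v: "vec (length Ds) x = 0\<^sub>v (length Ds)" using kerC by simp
      have "x j = 0" if "j < length Ds" for j using arg_cong[OF v, of "\<lambda>v. v $ j"] that by simp
      then show ?thesis by blast
    qed
    show "Poly_Mapping.lookup (V a i) 0 = 0" if "a < 3" "i < length ds" for a i
    proof -
      have "V a i \<in> elements_mat B" unfolding V_def by (rule elements_matI[OF cB that refl])
      then show ?thesis using minB lookup_max_ideal_0 by blast
    qed
    show "Poly_Mapping.lookup (W i j) 0 = 0" if "i < length ds" "j < length Ds" for i j
    proof -
      have "W i j \<in> elements_mat C" unfolding W_def by (rule elements_matI[OF cC that refl])
      then show ?thesis using minC lookup_max_ideal_0 by blast
    qed
    show "q dvd h" if q: "q \<noteq> 0" "\<forall>a<3. q dvd f a * h" for q h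
    proof (rule codim_2_grade[OF codim q(1), of "f ` {..<3}"])
      show "q dvd x * h" if "x \<in> f ` {..<3}" for x using that q(2) by auto
      show "I = ideal_of (f ` {..<3})"
      proof
        show "I \<subseteq> ideal_of (f ` {..<3})"
          unfolding I
        proof clarify
          fix c
          show "(\<Sum>a<3. c a * f a) \<in> ideal_of (f ` {..<3})"
            by (rule module.span_sum[OF module_times], rule module.span_scale[OF module_times],
                rule module.span_base[OF module_times]) auto
        qed
        show "ideal_of (f ` {..<3}) \<subseteq> I"
        proof (rule module.span_minimal[OF module_times])
          show "f ` {..<3} \<subseteq> I"
          proof clarify
            fix a :: nat assume "a < 3"
            then have "f a = (\<Sum>b<3. (if b = a then 1 else 0) * f b)"
              by (simp add: if_distrib[of "\<lambda>y. y * _"] cong: if_cong)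
            then show "f a \<in> I" unfolding I
              by (intro CollectI exI[of _ "\<lambda>b. if b = a then 1 else 0"] conjI TrueI)
          qed
          show "is_ideal I"
            unfolding module.subspace_def[OF module_times] I
          proof (intro conjI ballI allI)
            show "0 \<in> {\<Sum>a<3. c a * f a | c. True}" by (rule CollectI, rule exI[of _ "\<lambda>_. 0"]) simp
          next
            fix x y assume "x \<in> {\<Sum>a<3. c a * f a | c. True}" "y \<in> {\<Sum>a<3. c a * f a | c. True}"
            then obtain c c' where "x = (\<Sum>a<3. c a * f a)" "y = (\<Sum>a<3. c' a * f a)" by blast
            then have "x + y = (\<Sum>a<3. (c a + c' a) * f a)" by (simp add: sum.distrib distrib_right)
            then show "x + y \<in> {\<Sum>a<3. c a * f a | c. True}"
              by (intro CollectI exI[of _ "\<lambda>a. c a + c' a"] conjI TrueI)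
          next
            fix e x assume "x \<in> {\<Sum>a<3. c a * f a | c. True}"
            then obtain c where "x = (\<Sum>a<3. c a * f a)" by blast
            then have "e * x = (\<Sum>a<3. (e * c a) * f a)" by (simp add: sum_distrib_left mult.assoc)
            then show "e * x \<in> {\<Sum>a<3. c a * f a | c. True}"
              by (intro CollectI exI[of _ "\<lambda>a. e * c a"] conjI TrueI)
          qed
        qed
      qed
    qed
    show "length ds = length Ds + 2" by (rule len)
  qed
  with I show ?thesis by (rule that[rotated])
qed

theorem proposition1p6:
  fixes I G :: "'k::field R set"
    and d r :: nat
    and ds Ds :: "int list"
    and \<phi>s :: "'k R mat list"
  assumes "d \<ge> 1"
    and "card G = 3"
    and "\<And>g. g \<in> G \<Longrightarrow> homogeneous (int d) g"
    and "\<not> Modules.module.dependent scalar_mult G"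
    and "I = ideal_of G"
    and "codim I = 2"
    and "r \<ge> 3"
    and "length ds = r"
    and "length Ds = r - 2"
    and "minimal_graded_free_resolution I [[0], replicate 3 (int d), ds, Ds] \<phi>s"
    and "indeg_quotient (saturation I) I \<ge> enat (d + 1)"
  shows
    "(d = 5 \<longrightarrow> free_modules [[0], replicate 3 (int d), ds, Ds] =
       [{#0#}, replicate_mset 3 5, replicate_mset 3 8, {#9#}]) \<and>
     (d = 6 \<longrightarrow> free_modules [[0], replicate 3 (int d), ds, Ds] \<in>
       {[{#0#}, replicate_mset 3 6, replicate_mset 4 10, replicate_mset 2 11],
        [{#0#}, replicate_mset 3 6, replicate_mset 2 10 + {#9#}, {#11#}]}) \<and>
     (d = 7 \<longrightarrow> free_modules [[0], replicate 3 (int d), ds, Ds] \<in>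
       {[{#0#}, replicate_mset 3 7, replicate_mset 5 12, replicate_mset 3 13],
        [{#0#}, replicate_mset 3 7, replicate_mset 3 12 + {#11#}, replicate_mset 2 13],
        [{#0#}, replicate_mset 3 7, {#12#} + replicate_mset 2 11, {#13#}],
        [{#0#}, replicate_mset 3 7, replicate_mset 3 11, {#12#}],
        [{#0#}, replicate_mset 3 7, replicate_mset 2 12 + {#10#}, {#13#}]})"
proof -
  have len: "length ds = length Ds + 2" using assms(7-9) by simp
  have ideal: "is_ideal I" unfolding assms(5) by (rule module.subspace_span[OF module_times])
  obtain f V W where fVW: "three_form_resolution f V W d (length ds) (length Ds) (\<lambda>i. ds ! i) (\<lambda>j. Ds ! j)"
    and I: "I = {\<Sum>a<3. c a * f a | c. True}"
    by (rule resolution_of_length_3[OF assms(10) assms(6) len])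
  interpret three_form_resolution f V W d "length ds" "length Ds" "\<lambda>i. ds ! i" "\<lambda>j. Ds ! j" by (rule fVW)
  define xs where "xs = sort ds"
  define ys where "ys = sort Ds"
  have mset: "mset ds = mset xs" "mset Ds = mset ys" by (simp_all add: xs_def ys_def)
  have l: "length xs = length ys + 2" "length ys \<ge> 1" using len assms(7-9) by (simp_all add: xs_def ys_def)
  have gap: "xs ! (m + 2) < ys ! m" if "m < length ys" for m
    unfolding xs_def ys_def using that
    by (intro sorted_degree_gap[OF len degree_gap]) (simp_all add: ys_def)
  have top: "ys ! m \<le> 2 * int d - 1" if "m < length ys" for m
  proof -
    have "ys ! m \<in> set Ds" using nth_mem[OF that] by (simp add: ys_def)
    then obtain j where j: "j < length Ds" "Ds ! j = ys ! m" by (metis in_set_conv_nth)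
    have "Ds ! j \<le> 2 * int d - 1"
      by (rule last_degree_le[OF I _ j(1)]) (rule indeg_quotient_ge[OF assms(11) ideal])
    then show ?thesis by (simp add: j(2))
  qed
  have sorted: "sorted xs" by (simp add: xs_def)
  have "sum_list ds = 3 * int d + sum_list Ds"
    using degree_sum by (simp add: sum_list_sum_nth atLeast0LessThan)
  then have sum: "sum_list xs = 3 * int d + sum_list ys"
    unfolding xs_def ys_def by (metis mset_sort sum_mset_sum_list)
  have fm: "free_modules [[0], replicate 3 (int d), ds, Ds] = [{#0#}, replicate_mset 3 (int d), mset xs, mset ys]"
    by (simp add: free_modules_def mset)
  have rep: "replicate_mset 2 x = {#x, x#}" "replicate_mset 3 x = {#x, x, x#}"
    "replicate_mset 4 x = {#x, x, x, x#}" "replicate_mset 5 x = {#x, x, x, x, x#}" for x :: int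
    by (simp_all add: eval_nat_numeral)
  show ?thesis
    unfolding fm
  proof (intro conjI impI)
    assume d: "d = 5"
    have "xs = [8, 8, 8] \<and> ys = [9]"
      by (rule degree_lists_5[OF l gap _ sorted]) (use top sum d in auto)
    then show "[{#0#}, replicate_mset 3 (int d), mset xs, mset ys] = [{#0#}, replicate_mset 3 5, replicate_mset 3 8, {#9#}]"
      by (simp add: d rep)
  next
    assume d: "d = 6"
    have "(xs = [10, 10, 10, 10] \<and> ys = [11, 11]) \<or> (xs = [9, 10, 10] \<and> ys = [11])"
      by (rule degree_lists_6[OF l gap _ sorted]) (use top sum d in auto)
    then show "[{#0#}, replicate_mset 3 (int d), mset xs, mset ys] \<in>
       {[{#0#}, replicate_mset 3 6, replicate_mset 4 10, replicate_mset 2 11],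
        [{#0#}, replicate_mset 3 6, replicate_mset 2 10 + {#9#}, {#11#}]}"
      by (elim disjE) (simp_all add: d rep add_mset_commute)
  next
    assume d: "d = 7"
    have "(xs = [12, 12, 12, 12, 12] \<and> ys = [13, 13, 13]) \<or> (xs = [11, 12, 12, 12] \<and> ys = [13, 13]) \<or>
      (xs = [11, 11, 12] \<and> ys = [13]) \<or> (xs = [11, 11, 11] \<and> ys = [12]) \<or> (xs = [10, 12, 12] \<and> ys = [13])"
      by (rule degree_lists_7[OF l gap _ sorted]) (use top sum d in auto)
    then show "[{#0#}, replicate_mset 3 (int d), mset xs, mset ys] \<in>
       {[{#0#}, replicate_mset 3 7, replicate_mset 5 12, replicate_mset 3 13],
        [{#0#}, replicate_mset 3 7, replicate_mset 3 12 + {#11#}, replicate_mset 2 13],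
        [{#0#}, replicate_mset 3 7, {#12#} + replicate_mset 2 11, {#13#}],
        [{#0#}, replicate_mset 3 7, replicate_mset 3 11, {#12#}],
        [{#0#}, replicate_mset 3 7, replicate_mset 2 12 + {#10#}, {#13#}]}"
      by (elim disjE) (simp_all add: d rep add_mset_commute)
  qed
qed

end
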